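(* Let $N\ge 1$ be an integer. The polynomial $$F^{(0)}(z)=\sum_{j=1}^{N}\frac{U'_{2(N-j+1)}\left(\cos\frac{\pi}{2N+2}\right)}{U'_{2N}\left(\cos\frac{\pi}{2N+2}\right)}\,z^{2j-1}$$ is univalent (that is, injective) in the unit disc $\mathbb D=\{z\in\mathbb C:|z|<1\}$.
   Context: $U_j$ denotes the Chebyshev polynomial of the second kind, $U_j(\cos t)=\frac{\sin((j+1)t)}{\sin t}$, and $U_j'$ denotes its derivative $\frac{d}{dx}U_j(x)$. *)

theory Defs
  imports "HOL-Analysis.Analysis" "HOL-Computational_Algebra.Polynomial"
begin

definition cheb_U :: "nat \<Rightarrow> real poly" where
  "cheb_U j = (THE p. \<forall>t. sin t \<noteq> 0 \<longrightarrow> poly p (cos t) = sin (real (j + 1) * t) / sin t)"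

text \<open>
  The description is proper: such a polynomial exists (built by the three-term recurrence)
  and is unique, since it is determined on the infinite set \<open>{-1<..<1}\<close>.
\<close>

fun cheb_U_rec :: "nat \<Rightarrow> real poly" where
  "cheb_U_rec 0 = 1"
| "cheb_U_rec (Suc 0) = [:0, 2:]"
| "cheb_U_rec (Suc (Suc n)) = [:0, 2:] * cheb_U_rec (Suc n) - cheb_U_rec n"

lemma poly_cheb_U_rec_cos:
  "sin t * poly (cheb_U_rec j) (cos t) = sin (real (j + 1) * t)"
proof (induction j rule: cheb_U_rec.induct)
  case 1
  show ?case by simp
next
  case 2
  show ?case by (simp add: sin_double)
next
  case (3 n)
  define a where "a = real (n + 2) * t"
  have "sin t * poly (cheb_U_rec (Suc (Suc n))) (cos t)
      = 2 * cos t * (sin t * poly (cheb_U_rec (Suc n)) (cos t)) - sin t * poly (cheb_U_rec n) (cos t)"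
    by (simp add: algebra_simps)
  also have "\<dots> = 2 * cos t * sin a - sin (a - t)"
    unfolding 3 by (simp add: a_def algebra_simps)
  also have "\<dots> = sin (a + t)"
    by (simp add: sin_add sin_diff)
  also have "a + t = real (Suc (Suc n) + 1) * t"
    by (simp add: a_def algebra_simps)
  finally show ?case .
qed

lemma cheb_U_unique:
  assumes "\<forall>t. sin t \<noteq> 0 \<longrightarrow> poly p (cos t) = sin (real (j + 1) * t) / sin t"
  shows "p = cheb_U_rec j"
proof -
  have "poly (p - cheb_U_rec j) x = 0" if x: "x \<in> {-1<..<1}" for x
  proof -
    have c: "cos (arccos x) = x" using x by (intro cos_arccos) auto
    have s: "sin (arccos x) \<noteq> 0" using x by (intro sin_arccos_nonzero) auto
    have "sin (arccos x) * poly p x = sin (arccos x) * poly (cheb_U_rec j) x"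
      using s assms[rule_format, of "arccos x"] poly_cheb_U_rec_cos[of "arccos x" j]
      by (simp add: c)
    with s show ?thesis by simp
  qed
  then have "{-1<..<1} \<subseteq> {x. poly (p - cheb_U_rec j) x = 0}" by blast
  moreover have "infinite {-1<..<1::real}" by simp
  ultimately have "infinite {x. poly (p - cheb_U_rec j) x = 0}"
    using finite_subset by blast
  then have "p - cheb_U_rec j = 0" using poly_roots_finite by blast
  then show ?thesis by simp
qed

lemma cheb_U_eq_rec: "cheb_U j = cheb_U_rec j"
  unfolding cheb_U_def
proof (rule the_equality)
  show "\<forall>t. sin t \<noteq> 0 \<longrightarrow> poly (cheb_U_rec j) (cos t) = sin (real (j + 1) * t) / sin t"
    using poly_cheb_U_rec_cos[of _ j] by (simp add: field_simps)
qed (rule cheb_U_unique)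

lemma poly_cheb_U_cos:
  assumes "sin t \<noteq> 0"
  shows "poly (cheb_U j) (cos t) = sin (real (j + 1) * t) / sin t"
  using assms poly_cheb_U_rec_cos[of t j] by (simp add: cheb_U_eq_rec field_simps)

definition F0 :: "nat \<Rightarrow> complex \<Rightarrow> complex" where
  "F0 N z = (\<Sum>j=1..N. complex_of_real
       (poly (pderiv (cheb_U (2 * (N - j + 1)))) (cos (pi / (2 * real N + 2)))
         / poly (pderiv (cheb_U (2 * N))) (cos (pi / (2 * real N + 2))))
       * z ^ (2 * j - 1))"

end

theory Submission
  imports Defs "HOL-Complex_Analysis.Complex_Analysis"
begin

text \<open>
  Put \<open>M = N + 1\<close>, \<open>\<theta> = \<pi> / (2 M)\<close>, \<open>s = sin \<theta>\<close> and \<open>D t = sin\<^sup>2 t - s\<^sup>2\<close>. The values of the polynomial \<open>F\<close> on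
  the unit circle have a closed form: with \<open>X + i Y = F (e\<^sup>i\<^sup>t)\<close>,
  \<open>2 M D\<^sup>2 (X + i Y) = i M D sin t + (1 + e\<^sup>2\<^sup>i\<^sup>M\<^sup>t) s\<^sup>2 cos t\<close> (lemma \<open>F0_cis\<close>). In particular \<open>X\<close> is a
  nonnegative multiple of \<open>cos t\<close>, so \<open>F\<close> maps the right half of the disc into the right half
  plane (lemma \<open>Re_F0_pos\<close>). As \<open>F\<close> is odd and real, the left half goes to the left half plane and
  the imaginary diameter into the imaginary axis. It therefore suffices to prove injectivity on the
  right half disc and on the imaginary diameter.

  For large \<open>N\<close> the image of the right half disc is far from convex: its boundary touches the
  imaginary axis many times. The shape of the boundary is nevertheless simple enough. On the arc \<open>0 < t < 2 \<theta>\<close>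
  the curve moves to the left (\<open>X' \<le> 0\<close>, lemma \<open>X'_nonpos\<close>), and on \<open>2 \<theta> < t < \<pi> / 2\<close> it moves
  downwards (\<open>Y' \<le> 0\<close>, lemma \<open>Y'_nonpos\<close>). These are the directions in which the boundary of the
  half strip \<open>{Re > 0, \<bar>Im\<bar> < \<pi> / 2}\<close> runs, if the half strip is mapped onto the right
  half disc such that its corners correspond to \<open>e\<^sup>\<plusminus>\<^sup>2\<^sup>i\<^sup>\<theta>\<close>. That conformal map is explicit: \<open>\<zeta>\<close> and \<open>z\<close>
  correspond when \<open>sinh \<zeta> = 2 sin (2 \<theta>) z / (1 - z\<^sup>2)\<close>. Call it \<open>p\<close>. The two sign conditions
  say that \<open>(F \<circ> p)'\<close> has nonnegative real part at the boundary. By the minimum principle it has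
  positive real part inside (lemma \<open>h_quotient_Re_pos\<close>), and a function on a convex domain whose
  derivative has positive real part is injective (lemma \<open>inj_on_of_Re_deriv_pos\<close>; this is the
  theorem of Noshiro and Warschawski).

  In terms of \<open>w = z\<^sup>2\<close> the derivative of \<open>F \<circ> p\<close> is, up to a positive factor, \<open>h w / (1 + w)\<close>, where \<open>h\<close>
  is \<open>F' z\<close> times \<open>1 - w\<close> times a square root with branch points at \<open>e\<^sup>\<plusminus>\<^sup>4\<^sup>i\<^sup>\<theta>\<close>.
  This is holomorphic on the whole unit disc, which is why the minimum principle can be applied there
  and not only on the half disc. The only difficulty is the possible pole at \<open>w = -1\<close>; its
  coefficient is nonnegative, so it does no harm (lemma \<open>Re_nonneg_simple_pole\<close>).
\<close>

section \<open>The coefficients and the closed form on the unit circle\<close>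

lemma pderiv_cheb_U_cos:
  "sin t ^ 3 * poly (pderiv (cheb_U j)) (cos t)
     = sin (real (j + 1) * t) * cos t - real (j + 1) * cos (real (j + 1) * t) * sin t"
proof -
  let ?p = "cheb_U j"
  have "((\<lambda>t. sin t * poly ?p (cos t)) has_real_derivative
          cos t * poly ?p (cos t) + sin t * (poly (pderiv ?p) (cos t) * (- sin t))) (at t)"
    by (auto intro!: derivative_eq_intros DERIV_chain2[OF poly_DERIV])
  moreover have "((\<lambda>t. sin t * poly ?p (cos t)) has_real_derivative
          cos (real (j + 1) * t) * real (j + 1)) (at t)"
    unfolding cheb_U_eq_rec poly_cheb_U_rec_cos by (auto intro!: derivative_eq_intros)
  ultimately have eq: "cos t * poly ?p (cos t) - sin t ^ 2 * poly (pderiv ?p) (cos t)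
      = real (j + 1) * cos (real (j + 1) * t)"
    using DERIV_unique by (fastforce simp: power2_eq_square algebra_simps)
  have "sin t ^ 3 * poly (pderiv ?p) (cos t)
     = sin t * poly ?p (cos t) * cos t
       - sin t * (cos t * poly ?p (cos t) - sin t ^ 2 * poly (pderiv ?p) (cos t))"
    by (simp add: algebra_simps power2_eq_square power3_eq_cube)
  then show ?thesis unfolding eq unfolding cheb_U_eq_rec poly_cheb_U_rec_cos by simp
qed

text \<open>
  The coefficients of \<open>F\<close> combine \<open>sin (m \<theta>)\<close> with \<open>(2 M - m) cos (m \<theta>)\<close> for odd \<open>m\<close>. Expanding the
  sine and the cosine into exponentials leaves geometric sums and sums with an additional
  arithmetic factor; the next two lemmas evaluate these.
\<close>
lemma sum_odd_powers:
  fixes x :: complex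
  shows "(1 - x\<^sup>2) * (\<Sum>j=1..n. x ^ (2 * j - 1)) = x * (1 - x ^ (2 * n))"
proof (induction n)
  case (Suc n)
  have "(1 - x\<^sup>2) * (\<Sum>j=1..Suc n. x ^ (2 * j - 1))
      = (1 - x\<^sup>2) * (\<Sum>j=1..n. x ^ (2 * j - 1)) + (1 - x\<^sup>2) * (x * x ^ (2 * n))"
    by (simp add: distrib_left)
  also have "\<dots> = x * (1 - x ^ (2 * Suc n))"
    unfolding Suc by (simp add: algebra_simps power2_eq_square)
  finally show ?case .
qed simp

lemma sum_odd_powers_arith:
  fixes x :: complex and c :: real
  shows "(1 - x\<^sup>2)\<^sup>2 * (\<Sum>j=1..n. of_real (c - real (2 * j - 1)) * x ^ (2 * j - 1))
    = x * ((c + 1) - (c + 1 - 2 * of_nat n) * x ^ (2 * n)) * (1 - x\<^sup>2) - 2 * x * (1 - x ^ (2 * n))"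
proof (induction n)
  case (Suc n)
  have "(1 - x\<^sup>2)\<^sup>2 * (\<Sum>j=1..Suc n. of_real (c - real (2 * j - 1)) * x ^ (2 * j - 1))
      = (1 - x\<^sup>2)\<^sup>2 * (\<Sum>j=1..n. of_real (c - real (2 * j - 1)) * x ^ (2 * j - 1))
        + (1 - x\<^sup>2)\<^sup>2 * ((c - 1 - 2 * of_nat n) * (x * x ^ (2 * n)))"
    by (simp add: distrib_left)
  also have "\<dots> = x * ((c + 1) - (c + 1 - 2 * of_nat (Suc n)) * x ^ (2 * Suc n)) * (1 - x\<^sup>2)
      - 2 * x * (1 - x ^ (2 * Suc n))"
    unfolding Suc by (simp add: algebra_simps power2_eq_square)
  finally show ?case .
qed (simp add: algebra_simps)

text \<open>
  For \<open>N = 1\<close> the polynomial is \<open>z\<close>. From \<open>N = 2\<close> on, \<open>6 \<theta> \<le> \<pi>\<close>, so that the arcs of length \<open>2 \<theta>\<close>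
  and \<open>3 \<theta>\<close> used below lie within a quarter of the circle.
\<close>
locale cheb_param =
  fixes N :: nat
  assumes N2: "2 \<le> N"
begin

definition M :: real where "M = real N + 1"
definition \<theta> :: real where "\<theta> = pi / (2 * M)"
definition s :: real where "s = sin \<theta>"
definition a :: "nat \<Rightarrow> real" where
  "a j = poly (pderiv (cheb_U (2 * (N - j + 1)))) (cos (pi / (2 * real N + 2)))
         / poly (pderiv (cheb_U (2 * N))) (cos (pi / (2 * real N + 2)))"

lemma F0_a: "F0 N z = (\<Sum>j=1..N. of_real (a j) * z ^ (2 * j - 1))"
  by (simp add: F0_def a_def)

lemma M3: "3 \<le> M" using N2 by (simp add: M_def)
lemma M_theta: "M * \<theta> = pi / 2" using M3 by (simp add: \<theta>_def)
lemma theta_pos: "0 < \<theta>" using M3 by (simp add: \<theta>_def)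
lemma theta_le: "6 * \<theta> \<le> pi"
  using M3 M_theta theta_pos mult_right_mono[of 3 M \<theta>] by linarith
lemma s_pos: "0 < s" unfolding s_def using theta_pos theta_le by (intro sin_gt_zero) auto
lemma cos_theta_pos: "0 < cos \<theta>" using theta_pos theta_le by (intro cos_gt_zero_pi) auto

text \<open>
  With \<open>m = 2 j - 1\<close> the Chebyshev polynomial of index \<open>2 M - m - 1\<close> involves the angle \<open>(2 M - m) \<theta> = \<pi> - m \<theta>\<close>,
  which is why everything can be written with the angle \<open>m \<theta>\<close>.
\<close>
lemma a_eq:
  assumes "1 \<le> j" "j \<le> N"
  shows "a j = (sin (real (2*j-1) * \<theta>) * cos \<theta> + (2 * M - real (2*j-1)) * cos (real (2*j-1) * \<theta>) * s)
    / (2 * M * s * cos \<theta>)"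
proof -
  have th: "pi / (2 * real N + 2) = \<theta>" by (simp add: \<theta>_def M_def algebra_simps)
  have *: "s ^ 3 * poly (pderiv (cheb_U (2 * (N - j + 1)))) (cos \<theta>)
    = sin (real (2*j-1) * \<theta>) * cos \<theta> + (2 * M - real (2*j-1)) * cos (real (2*j-1) * \<theta>) * s"
    if "1 \<le> j" "j \<le> N" for j
  proof -
    have r: "real (2 * (N - j + 1) + 1) = 2 * M - real (2*j-1)"
      using that by (simp add: M_def of_nat_diff)
    have e: "(2 * M - real (2*j-1)) * \<theta> = pi - real (2*j-1) * \<theta>"
      using M_theta by (simp add: algebra_simps)
    show ?thesis
      unfolding s_def pderiv_cheb_U_cos r e by (simp add: cos_diff sin_diff)
  qed
  have "s ^ 3 * poly (pderiv (cheb_U (2 * N))) (cos \<theta>) = 2 * M * s * cos \<theta>"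
    using *[of 1] N2 by (simp add: algebra_simps s_def)
  then have "a j = (s ^ 3 * poly (pderiv (cheb_U (2 * (N - j + 1)))) (cos \<theta>)) / (2 * M * s * cos \<theta>)"
    using s_pos unfolding a_def th by (metis less_irrefl mult_divide_mult_cancel_left power_not_zero)
  then show ?thesis by (simp only: *[OF assms])
qed

lemma a_one: "a 1 = 1"
proof -
  have "2 * M * s * cos \<theta> \<noteq> 0" using M3 s_pos cos_theta_pos by simp
  then show ?thesis using a_eq[of 1] N2 by (simp add: s_def algebra_simps divide_simps)
qed

definition D :: "real \<Rightarrow> real" where "D t = (sin t)\<^sup>2 - s\<^sup>2"

text \<open>
  The products \<open>x = e\<^sup>i\<^sup>(\<^sup>t\<^sup>+\<^sup>\<theta>\<^sup>)\<close> and \<open>y = e\<^sup>i\<^sup>(\<^sup>t\<^sup>-\<^sup>\<theta>\<^sup>)\<close> both satisfy \<open>x\<^sup>2\<^sup>M = y\<^sup>2\<^sup>M = - e\<^sup>2\<^sup>i\<^sup>M\<^sup>t\<close>, because \<open>2 M \<theta> = \<pi>\<close>.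
  Hence the geometric sums at \<open>x\<close> and \<open>y\<close> collapse to the same expression. The identity is stated
  with the factor \<open>D\<^sup>2\<close> multiplied out, so that it also holds at the zeros \<open>\<plusminus>\<theta>\<close> of \<open>D\<close>.
\<close>
lemma F0_cis:
  "2 * of_real M * of_real (D t) ^ 2 * F0 N (cis t)
     = \<i> * of_real (M * sin t * D t) + (1 + cis (2 * M * t)) * of_real (s\<^sup>2 * cos t)"
proof -
  define c where "c = cos \<theta>"
  define z where "z = cis t"
  define om where "om = cis \<theta>"
  define x where "x = z * om"
  define y where "y = z * cnj om"
  define P where "P u = (\<Sum>j=1..N+1. u ^ (2 * j - 1))" for u :: complex
  define Q where "Q u = (\<Sum>j=1..N+1. of_real (2*M - real (2 * j - 1)) * u ^ (2 * j - 1))" for u :: complex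
  define v where "v = cis (2 * M * t)"
  have omom: "om * cnj om = 1" by (simp add: om_def cis_cnj cis_mult)
  have zz: "z * cnj z = 1" by (simp add: z_def cis_cnj cis_mult)
  have c_om: "of_real c = (om + cnj om) / 2" by (simp add: om_def c_def complex_eq_iff)
  have s_om: "of_real s = (om - cnj om) / (2 * \<i>)" by (simp add: om_def s_def complex_eq_iff)
  have ct: "of_real (cos t) = (z + cnj z) / 2" by (simp add: z_def complex_eq_iff)
  have st: "of_real (sin t) = (z - cnj z) / (2*\<i>)" by (simp add: z_def complex_eq_iff)
  have xp: "x ^ (2 * (N + 1)) = - v"
  proof -
    have "x = cis (t + \<theta>)" by (simp add: x_def z_def om_def cis_mult)
    then have "x ^ (2 * (N + 1)) = cis (real (2 * (N+1)) * (t + \<theta>))" by (simp only: Complex.DeMoivre)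
    also have "real (2 * (N+1)) * (t + \<theta>) = 2 * M * t + pi"
      using M_theta by (simp add: M_def algebra_simps)
    finally show ?thesis by (simp add: v_def cis_mult[symmetric])
  qed
  have yp: "y ^ (2 * (N + 1)) = - v"
  proof -
    have "y = cis (t - \<theta>)" by (simp add: y_def z_def om_def cis_mult cis_cnj)
    then have "y ^ (2 * (N + 1)) = cis (real (2 * (N+1)) * (t - \<theta>))" by (simp only: Complex.DeMoivre)
    also have "real (2 * (N+1)) * (t - \<theta>) = 2 * M * t - pi"
      using M_theta by (simp add: M_def algebra_simps)
    finally show ?thesis by (simp add: v_def cis_divide[symmetric])
  qed
  have P: "(1 - u\<^sup>2) * P u = u * (1 + v)" if "u ^ (2 * (N + 1)) = - v" for u
    unfolding P_def sum_odd_powers that by simp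
  have Q: "(1 - u\<^sup>2)\<^sup>2 * Q u = u * (2 * of_real M * (1 - u\<^sup>2) - (1 + v) * (1 + u\<^sup>2))"
    if "u ^ (2 * (N + 1)) = - v" for u :: complex
    unfolding Q_def sum_odd_powers_arith that by (simp add: M_def algebra_simps power2_eq_square)
  have "2 * of_real M * of_real s * of_real c * F0 N z
     = (\<Sum>j=1..N. (of_real c / (2 * \<i>)) * (x ^ (2 * j - 1) - y ^ (2 * j - 1))
         + (of_real s / 2) * (of_real (2*M - real (2 * j - 1)) * x ^ (2 * j - 1)
            + of_real (2*M - real (2 * j - 1)) * y ^ (2 * j - 1)))"
    unfolding F0_a sum_distrib_left
  proof (rule sum.cong[OF refl])
    fix j assume j: "j \<in> {1..N}"
    define m where "m = 2 * j - 1"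
    have nz: "2 * M * s * c \<noteq> 0" using M3 s_pos cos_theta_pos by (simp add: c_def)
    have am: "2 * M * s * c * a j = sin (real m * \<theta>) * c + (2 * M - real m) * cos (real m * \<theta>) * s"
      using a_eq[of j] j nz unfolding m_def c_def by simp
    have om: "om ^ m = cis (real m * \<theta>)" by (simp add: om_def Complex.DeMoivre)
    have S: "of_real (sin (real m * \<theta>)) = (om ^ m - cnj om ^ m) / (2*\<i>)"
      unfolding complex_cnj_power[symmetric] om by (simp add: complex_eq_iff)
    have C: "of_real (cos (real m * \<theta>)) = (om ^ m + cnj om ^ m) / 2"
      unfolding complex_cnj_power[symmetric] om by (simp add: complex_eq_iff)
    have "2 * of_real M * of_real s * of_real c * (of_real (a j) * z ^ m) = of_real (2 * M * s * c * a j) * z ^ m"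
      by simp
    also have "\<dots> = (((om ^ m - cnj om ^ m) / (2*\<i>)) * of_real c
        + of_real (2 * M - real m) * ((om ^ m + cnj om ^ m) / 2) * of_real s) * z ^ m"
      unfolding am of_real_add of_real_mult S C ..
    also have "\<dots> = (of_real c / (2 * \<i>)) * (x ^ m - y ^ m)
         + (of_real s / 2) * (of_real (2*M - real m) * x ^ m + of_real (2*M - real m) * y ^ m)"
      unfolding x_def y_def power_mult_distrib by (simp add: algebra_simps add_divide_distrib diff_divide_distrib)
    finally show "2 * of_real M * of_real s * of_real c * (of_real (a j) * z ^ (2 * j - 1)) =
         (of_real c / (2 * \<i>)) * (x ^ (2 * j - 1) - y ^ (2 * j - 1))
         + (of_real s / 2) * (of_real (2*M - real (2 * j - 1)) * x ^ (2 * j - 1)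
            + of_real (2*M - real (2 * j - 1)) * y ^ (2 * j - 1))"
      unfolding m_def .
  qed
  \<comment> \<open>The term with \<open>j = N + 1\<close> vanishes, and including it makes the length of the sum equal to \<open>M\<close>.\<close>
  also have "\<dots> = (\<Sum>j=1..N+1. (of_real c / (2 * \<i>)) * (x ^ (2 * j - 1) - y ^ (2 * j - 1))
         + (of_real s / 2) * (of_real (2*M - real (2 * j - 1)) * x ^ (2 * j - 1)
            + of_real (2*M - real (2 * j - 1)) * y ^ (2 * j - 1)))"
  proof -
    let ?m = "2 * (N + 1) - 1"
    have xm: "x ^ ?m * x = - v" "y ^ ?m * y = - v"
      using xp yp by (simp_all add: mult.commute)
    have xn: "x * (cnj z * cnj om) = 1" "y * (cnj z * om) = 1"
      using omom zz unfolding x_def y_def by (simp_all add: algebra_simps) (metis mult.assoc mult.commute mult_1)+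
    have x1: "x ^ ?m = - v * (cnj z * cnj om)" "y ^ ?m = - v * (cnj z * om)"
      using xm xn by (metis mult.assoc mult.right_neutral)+
    have r: "2 * M - real ?m = 1" by (simp add: M_def)
    have is0: "\<i> * of_real s = (om - cnj om) / 2" by (simp add: om_def s_def complex_eq_iff)
    have "of_real c * (x ^ ?m - y ^ ?m) + \<i> * of_real s * (x ^ ?m + y ^ ?m) = 0"
      unfolding x1 c_om is0 by (simp add: field_simps)
    moreover have "(of_real c / (2 * \<i>)) * (x ^ ?m - y ^ ?m)
         + (of_real s / 2) * (of_real (2*M - real ?m) * x ^ ?m + of_real (2*M - real ?m) * y ^ ?m)
        = (of_real c * (x ^ ?m - y ^ ?m) + \<i> * of_real s * (x ^ ?m + y ^ ?m)) / (2 * \<i>)"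
      unfolding r by (simp add: divide_simps algebra_simps)
    ultimately have "(of_real c / (2 * \<i>)) * (x ^ ?m - y ^ ?m)
         + (of_real s / 2) * (of_real (2*M - real ?m) * x ^ ?m + of_real (2*M - real ?m) * y ^ ?m) = 0"
      by simp
    then show ?thesis by simp
  qed
  also have "\<dots> = (of_real c / (2 * \<i>)) * (P x - P y) + (of_real s / 2) * (Q x + Q y)"
    unfolding P_def Q_def by (simp only: sum.distrib sum_distrib_left[symmetric] sum_subtractf)
  finally have F: "2 * of_real M * of_real s * of_real c * F0 N z
      = (of_real c / (2 * \<i>)) * (P x - P y) + (of_real s / 2) * (Q x + Q y)" .
  define A where "A = 1 - x\<^sup>2"
  define B where "B = 1 - y\<^sup>2"
  have isom: "2 * \<i> * of_real s = om - cnj om" by (simp add: om_def s_def complex_eq_iff)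
  have c2: "2 * of_real c = om + cnj om" by (simp add: c_om)
  have it: "2 * \<i> * of_real (sin t) = z - cnj z" by (simp add: z_def complex_eq_iff)
  have c2t: "2 * of_real (cos t) = z + cnj z" by (simp add: ct)
  have ii: "\<i> * \<i> = -1" by simp
  have Dq: "- 4 * z\<^sup>2 * of_real (D t) = A * B"
  proof -
    have "4 * of_real (D t) = (om - cnj om)\<^sup>2 - (z - cnj z)\<^sup>2"
      unfolding D_def of_real_diff of_real_power isom[symmetric] it[symmetric]
      by (simp add: power_mult_distrib algebra_simps)
    then show ?thesis unfolding A_def B_def x_def y_def using omom zz by algebra
  qed
  have PP: "A * P x = x * (1 + v)" "B * P y = y * (1 + v)"
    unfolding A_def B_def using P xp yp by auto
  have QQ: "A\<^sup>2 * Q x = x * (2 * of_real M * A - (1 + v) * (1 + x\<^sup>2))"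
     "B\<^sup>2 * Q y = y * (2 * of_real M * B - (1 + v) * (1 + y\<^sup>2))"
    unfolding A_def B_def using Q xp yp by auto
  \<comment> \<open>The next two identities collect the coefficients of \<open>M\<close> and of \<open>1 + v\<close>.\<close>
  have i1: "B * x + A * y = - (z ^ 2 * (z - cnj z) * (om + cnj om))"
    unfolding A_def B_def x_def y_def using omom zz by algebra
  have i2: "(om + cnj om) * (A * B) * (B * x - A * y) - (om - cnj om) * (B\<^sup>2 * (x * (1 + x\<^sup>2)) + A\<^sup>2 * (y * (1 + y\<^sup>2)))
     = - (2 * z ^ 4 * (om - cnj om) ^ 3 * (om + cnj om) * (z + cnj z))"
    unfolding A_def B_def x_def y_def using omom zz by algebra
  have v1: "16 * z ^ 4 * of_real (D t) ^ 2 = (A * B)\<^sup>2"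
    unfolding Dq[symmetric] by (simp add: power_mult_distrib)
  let ?K = "4 * \<i> * of_real s * of_real c * (16 * z ^ 4)"
  have "?K * (2 * of_real M * of_real (D t) ^ 2 * F0 N z)
    = (16 * z ^ 4 * of_real (D t) ^ 2) * (4 * \<i> * (2 * of_real M * of_real s * of_real c * F0 N z))"
    by (simp add: mult_ac)
  also have "\<dots> = (A * B)\<^sup>2 * ((2 * of_real c) * (P x - P y) + (2 * \<i> * of_real s) * (Q x + Q y))"
  proof -
    have "4 * \<i> * ((of_real c / (2 * \<i>)) * u + (of_real s / 2) * w)
        = (2 * of_real c) * u + (2 * \<i> * of_real s) * w" for u w
      by (simp add: divide_simps) (simp add: algebra_simps)
    then show ?thesis unfolding v1 F by simp
  qed
  also have "\<dots> = (om + cnj om) * (A * B) * (B * (A * P x) - A * (B * P y))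
       + (om - cnj om) * (B\<^sup>2 * (A\<^sup>2 * Q x) + A\<^sup>2 * (B\<^sup>2 * Q y))"
    unfolding isom c2 by (simp add: algebra_simps power2_eq_square)
  also have "\<dots> = (1 + v) * ((om + cnj om) * (A * B) * (B * x - A * y)
        - (om - cnj om) * (B\<^sup>2 * (x * (1 + x\<^sup>2)) + A\<^sup>2 * (y * (1 + y\<^sup>2))))
      + 2 * of_real M * (om - cnj om) * (A * B) * (B * x + A * y)"
    unfolding PP QQ by (simp add: algebra_simps power2_eq_square)
  also have "\<dots> = (om - cnj om) * (om + cnj om) *
      (- (2 * (1 + v) * z ^ 4 * (om - cnj om) ^ 2 * (z + cnj z))
        - 2 * of_real M * z\<^sup>2 * (z - cnj z) * (A * B))"
    unfolding i1 i2 by (simp add: algebra_simps power2_eq_square power3_eq_cube)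
  also have "\<dots> = ?K * (\<i> * of_real (M * sin t * D t) + (1 + v) * of_real (s\<^sup>2 * cos t))"
    unfolding Dq[symmetric] isom[symmetric] c2[symmetric] it[symmetric] c2t[symmetric]
      of_real_mult of_real_power
    using ii by algebra
  finally have "?K * (2 * of_real M * of_real (D t) ^ 2 * F0 N z)
     = ?K * (\<i> * of_real (M * sin t * D t) + (1 + v) * of_real (s\<^sup>2 * cos t))" .
  moreover have "?K \<noteq> 0"
    using s_pos cos_theta_pos by (simp add: c_def z_def)
  ultimately show ?thesis unfolding z_def v_def by (metis mult_left_cancel)
qed

end

section \<open>The direction of the boundary curve\<close>

lemma abs_sin_mult_le: "\<bar>sin (real n * x)\<bar> \<le> real n * \<bar>sin x\<bar>"
proof (induction n)
  case (Suc n)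
  have "sin (real (Suc n) * x) = sin (real n * x) * cos x + cos (real n * x) * sin x"
    by (simp add: algebra_simps sin_add)
  also have "\<bar>\<dots>\<bar> \<le> \<bar>sin (real n * x)\<bar> * \<bar>cos x\<bar> + \<bar>cos (real n * x)\<bar> * \<bar>sin x\<bar>"
    by (metis abs_mult abs_triangle_ineq)
  also have "\<dots> \<le> \<bar>sin (real n * x)\<bar> * 1 + 1 * \<bar>sin x\<bar>"
    by (intro add_mono mult_left_mono mult_right_mono) auto
  finally show ?case using Suc by (simp add: algebra_simps)
qed simp

context cheb_param begin

definition X :: "real \<Rightarrow> real" where "X t = Re (F0 N (cis t))"
definition Y :: "real \<Rightarrow> real" where "Y t = Im (F0 N (cis t))"
definition X' :: "real \<Rightarrow> real" where "X' t = (\<Sum>j=1..N. - a j * real (2*j-1) * sin (real (2*j-1) * t))"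
definition Y' :: "real \<Rightarrow> real" where "Y' t = (\<Sum>j=1..N. a j * real (2*j-1) * cos (real (2*j-1) * t))"

lemma X_sum: "X t = (\<Sum>j=1..N. a j * cos (real (2*j-1) * t))"
  unfolding X_def F0_a Re_sum by (simp add: Complex.DeMoivre)
lemma Y_sum: "Y t = (\<Sum>j=1..N. a j * sin (real (2*j-1) * t))"
  unfolding Y_def F0_a Im_sum by (simp add: Complex.DeMoivre)

lemma X_deriv: "(X has_real_derivative X' t) (at t)"
  unfolding X_sum[abs_def] X'_def by (auto intro!: derivative_eq_intros sum.cong)
lemma Y_deriv: "(Y has_real_derivative Y' t) (at t)"
  unfolding Y_sum[abs_def] Y'_def by (auto intro!: derivative_eq_intros sum.cong)

lemma D_deriv: "(D has_real_derivative 2 * sin t * cos t) (at t)"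
  unfolding D_def[abs_def] by (auto intro!: derivative_eq_intros)

lemma D_X: "2 * M * (D t)\<^sup>2 * X t = 2 * s\<^sup>2 * cos t * (cos (M * t))\<^sup>2"
proof -
  have "2 * M * (D t)\<^sup>2 * X t = Re (2 * of_real M * of_real (D t) ^ 2 * F0 N (cis t))"
    by (simp add: X_def flip: of_real_power)
  also have "\<dots> = (1 + cos (2 * (M * t))) * (s\<^sup>2 * cos t)"
    unfolding F0_cis by (simp flip: of_real_power add: mult.assoc)
  finally show ?thesis unfolding cos_double_cos by simp
qed

lemma D_Y: "2 * M * (D t)\<^sup>2 * Y t = M * sin t * D t + s\<^sup>2 * cos t * sin (2 * M * t)"
proof -
  have "2 * M * (D t)\<^sup>2 * Y t = Im (2 * of_real M * of_real (D t) ^ 2 * F0 N (cis t))"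
    by (simp add: Y_def flip: of_real_power)
  also have "\<dots> = M * sin t * D t + s\<^sup>2 * cos t * sin (2 * M * t)"
    unfolding F0_cis by (simp flip: of_real_power)
  finally show ?thesis .
qed

text \<open>
  The functions \<open>X\<close> and \<open>Y\<close> are quotients by \<open>D\<^sup>2\<close>. Differentiating the product form avoids the
  zeros of \<open>D\<close>.
\<close>
lemma deriv_of_quotient:
  assumes "\<And>t. 2 * M * (D t)\<^sup>2 * f t = A t"
    and "(f has_real_derivative f') (at t)" "(A has_real_derivative A') (at t)"
  shows "2 * M * D t ^ 3 * f' = D t * A' - 4 * sin t * cos t * A t"
proof -
  have "((\<lambda>t. 2 * M * (D t)\<^sup>2 * f t) has_real_derivative
     2 * M * (2 * D t * (2 * sin t * cos t)) * f t + 2 * M * (D t)\<^sup>2 * f') (at t)"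
    by (auto intro!: derivative_eq_intros D_deriv assms(2))
  then have "A' = 2 * M * (2 * D t * (2 * sin t * cos t)) * f t + 2 * M * (D t)\<^sup>2 * f'"
    unfolding assms(1) using assms(3) DERIV_unique by blast
  then show ?thesis unfolding assms(1)[symmetric]
    by (simp add: algebra_simps power2_eq_square power3_eq_cube)
qed

text \<open>
  As \<open>X\<close> is a positive multiple of \<open>cos t (cos (M t) / D)\<^sup>2\<close>, it decreases on those parts of \<open>[0, \<pi> / 2]\<close> where \<open>cos (M t) / D\<close>
  decreases in absolute value. The numerator of the logarithmic derivative of \<open>cos (M t) / D\<close> is
  the following function.
\<close>
definition lobe_num :: "real \<Rightarrow> real" where
  "lobe_num t = - M * D t * sin (M * t) - 2 * sin t * cos t * cos (M * t)"

lemma D_X': "2 * M * D t ^ 3 * X' t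
   = 4 * s\<^sup>2 * cos t * cos (M * t) * lobe_num t - 2 * s\<^sup>2 * sin t * D t * (cos (M * t))\<^sup>2"
proof -
  have "((\<lambda>t. 2 * s\<^sup>2 * cos t * (cos (M * t))\<^sup>2) has_real_derivative
     2 * s\<^sup>2 * (- sin t * (cos (M * t))\<^sup>2 - 2 * M * cos t * cos (M * t) * sin (M * t))) (at t)"
    by (auto intro!: derivative_eq_intros simp: algebra_simps)
  from deriv_of_quotient[OF D_X X_deriv this] show ?thesis
    unfolding lobe_num_def by (simp add: algebra_simps power2_eq_square)
qed

lemma D_Y': "- (2 * M * D t ^ 3 * Y' t)
   = M * cos t * (D t)\<^sup>2 + 4 * M * s\<^sup>2 * cos t * D t * (sin (M * t))\<^sup>2
     + s\<^sup>2 * sin t * sin (2 * M * t) * (D t + 4 * (cos t)\<^sup>2)"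
proof -
  have "((\<lambda>t. M * sin t * D t + s\<^sup>2 * cos t * sin (2 * M * t)) has_real_derivative
     M * cos t * D t + M * sin t * (2 * sin t * cos t)
      + s\<^sup>2 * (- sin t * sin (2 * M * t) + 2 * M * cos t * cos (2 * M * t))) (at t)"
    by (auto intro!: derivative_eq_intros D_deriv simp: algebra_simps)
  from deriv_of_quotient[OF D_Y Y_deriv this]
  have "- (2 * M * D t ^ 3 * Y' t) = - M * cos t * D t * (D t - 2 * (sin t)\<^sup>2)
     - 2 * M * s\<^sup>2 * cos t * D t * cos (2 * (M * t))
     + s\<^sup>2 * sin t * sin (2 * M * t) * (D t + 4 * (cos t)\<^sup>2)"
    by (simp add: algebra_simps power2_eq_square)
  moreover have "D t - 2 * (sin t)\<^sup>2 = - D t - 2 * s\<^sup>2" by (simp add: D_def)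
  ultimately show ?thesis
    unfolding cos_double_sin by (simp only:) (simp add: algebra_simps power2_eq_square)
qed

lemma lobe_num_deriv: "(lobe_num has_real_derivative - cos (M * t) * (M\<^sup>2 * D t + 2 * cos (2 * t))) (at t)"
proof -
  have "(lobe_num has_real_derivative - M * (2 * sin t * cos t) * sin (M * t) - M\<^sup>2 * D t * cos (M * t)
     - 2 * ((cos t)\<^sup>2 - (sin t)\<^sup>2) * cos (M * t) + 2 * M * sin t * cos t * sin (M * t)) (at t)"
    unfolding lobe_num_def[abs_def]
    by (auto intro!: derivative_eq_intros D_deriv simp: algebra_simps power2_eq_square)
  then show ?thesis unfolding cos_double by (simp add: algebra_simps)
qed

lemma D_mono: assumes "0 \<le> t" "t \<le> u" "u \<le> pi/2" shows "D t \<le> D u"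
proof -
  have "sin t \<le> sin u" using assms by (subst sin_mono_le_eq) auto
  moreover have "0 \<le> sin t" using assms by (intro sin_ge_zero) auto
  ultimately show ?thesis unfolding D_def by (simp add: power_mono)
qed

lemma D_theta: "D \<theta> = 0" by (simp add: D_def s_def)

lemma D_pos: assumes "\<theta> < t" "t \<le> pi/2" shows "0 < D t"
proof -
  have "s < sin t" unfolding s_def using assms theta_pos by (subst sin_mono_less_eq) auto
  then show ?thesis unfolding D_def using s_pos by (simp add: power_strict_mono)
qed

lemma D_neg: assumes "0 \<le> t" "t < \<theta>" shows "D t < 0"
proof -
  have "sin t < s" unfolding s_def using assms theta_le theta_pos by (subst sin_mono_less_eq) auto
  moreover have "0 \<le> sin t" using assms theta_le by (intro sin_ge_zero) auto
  ultimately show ?thesis unfolding D_def by (simp add: power_strict_mono)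
qed

lemma cos_M_nonneg: "0 \<le> t \<Longrightarrow> t \<le> \<theta> \<Longrightarrow> 0 \<le> cos (M * t)"
  using M3 M_theta mult_left_mono[of t \<theta> M] mult_nonneg_nonneg[of M t] pi_gt_zero
  by (intro cos_ge_zero) linarith+

lemma cos_M_nonpos: assumes "\<theta> \<le> t" "t \<le> 3 * \<theta>" shows "cos (M * t) \<le> 0"
proof -
  have "M * \<theta> \<le> M * t" "M * t \<le> M * (3 * \<theta>)" using assms M3 by (auto intro!: mult_left_mono)
  then have "0 \<le> cos (pi - M * t)" using M_theta by (intro cos_ge_zero) auto
  then show ?thesis by simp
qed

text \<open>
  In the derivative of the numerator the mixed terms cancel. What remains is \<open>- cos (M t)\<close>
  times a function that increases on \<open>[0, \<pi> / 2]\<close> and is nonnegative at \<open>\<theta>\<close>.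
  So on \<open>[0, \<theta>]\<close> the numerator first increases and then decreases; it vanishes at both ends,
  hence it is nonnegative. Beyond \<open>\<theta>\<close>, where \<open>cos (M t) \<le> 0\<close>, it increases from \<open>0\<close>.
\<close>
lemma lobe_num_nonneg: assumes "0 \<le> t" "t \<le> 3 * \<theta>" shows "0 \<le> lobe_num t"
proof -
  let ?b = "\<lambda>t. M\<^sup>2 * D t + 2 * cos (2 * t)"
  have b_alt: "?b t = (M\<^sup>2 - 4) * (sin t)\<^sup>2 - M\<^sup>2 * s\<^sup>2 + 2" for t
    unfolding D_def cos_double_sin by (simp add: algebra_simps)
  have b_mono: "?b t \<le> ?b u" if "0 \<le> t" "t \<le> u" "u \<le> pi/2" for t u
  proof -
    have "(sin t)\<^sup>2 \<le> (sin u)\<^sup>2" using D_mono[OF that] by (simp add: D_def)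
    moreover have "0 \<le> M\<^sup>2 - 4" using M3 power_mono[of 2 M 2] by simp
    ultimately show ?thesis unfolding b_alt by (simp add: mult_left_mono)
  qed
  have b_theta: "0 \<le> ?b \<theta>" using theta_pos theta_le unfolding D_theta by (simp add: cos_ge_zero)
  have N0: "lobe_num 0 = 0" by (simp add: lobe_num_def)
  have Nth: "lobe_num \<theta> = 0" by (simp add: lobe_num_def D_theta M_theta)
  show ?thesis
  proof (cases "t \<le> \<theta>")
    case True
    show ?thesis
    proof (cases "?b t \<le> 0")
      case b: True
      have "lobe_num 0 \<le> lobe_num t"
      proof (rule DERIV_nonneg_imp_nondecreasing[OF assms(1)])
        fix x assume x: "0 \<le> x" "x \<le> t"
        have "?b x \<le> 0" using b_mono[of x t] x b True theta_le theta_pos by linarith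
        moreover have "0 \<le> cos (M * x)" using cos_M_nonneg x True by auto
        ultimately show "\<exists>y. (lobe_num has_real_derivative y) (at x) \<and> 0 \<le> y"
          using lobe_num_deriv[of x] by (metis mult_minus_left mult_nonneg_nonpos neg_0_le_iff_le)
      qed
      then show ?thesis using N0 by simp
    next
      case b: False
      have "lobe_num t \<ge> lobe_num \<theta>"
      proof (rule DERIV_nonpos_imp_nonincreasing[OF True])
        fix x assume x: "t \<le> x" "x \<le> \<theta>"
        have "0 \<le> ?b x" using b_mono[of t x] x b True theta_le theta_pos assms by linarith
        moreover have "0 \<le> cos (M * x)" using cos_M_nonneg x assms by auto
        ultimately show "\<exists>y. (lobe_num has_real_derivative y) (at x) \<and> y \<le> 0"
          using lobe_num_deriv[of x] by (metis mult_minus_left mult_nonneg_nonneg neg_le_0_iff_le)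
      qed
      then show ?thesis using Nth by simp
    qed
  next
    case False
    have "lobe_num \<theta> \<le> lobe_num t"
    proof (rule DERIV_nonneg_imp_nondecreasing[of \<theta> t])
      show "\<theta> \<le> t" using False by simp
    next
      fix x assume x: "\<theta> \<le> x" "x \<le> t"
      have "0 \<le> ?b x" using b_mono[of \<theta> x] x b_theta theta_le theta_pos assms by linarith
      moreover have "cos (M * x) \<le> 0" using cos_M_nonpos x assms by auto
      ultimately show "\<exists>y. (lobe_num has_real_derivative y) (at x) \<and> 0 \<le> y"
        using lobe_num_deriv[of x] by (metis mult_minus_left mult_nonpos_nonneg neg_0_le_iff_le)
    qed
    then show ?thesis using Nth by simp
  qed
qed

text \<open>
  The factor \<open>cos (M t) / D\<close> is at most \<open>0\<close> on both sides of \<open>\<theta>\<close>, since numerator and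
  denominator change sign there together.
\<close>
lemma X'_nonpos:
  assumes "0 < t" "t \<le> 3 * \<theta>" "t \<noteq> \<theta>" shows "X' t \<le> 0"
proof -
  have tp: "t \<le> pi/2" using assms theta_le by simp
  have s: "0 \<le> sin t" "0 \<le> cos t" using assms tp by (auto intro!: sin_ge_zero cos_ge_zero)
  have N: "0 \<le> 4 * s\<^sup>2 * cos t * lobe_num t" using s lobe_num_nonneg assms by simp
  show ?thesis
  proof (cases "t < \<theta>")
    case True
    then have d: "D t < 0" and "0 \<le> cos (M * t)" using D_neg cos_M_nonneg assms by auto
    then have "0 \<le> (4 * s\<^sup>2 * cos t * lobe_num t) * cos (M * t) + 2 * s\<^sup>2 * sin t * (- D t) * (cos (M * t))\<^sup>2"
      using s by (intro add_nonneg_nonneg mult_nonneg_nonneg[OF N] mult_nonneg_nonneg) auto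
    then have "0 \<le> 2 * M * D t ^ 3 * X' t" unfolding D_X' by (simp add: algebra_simps)
    moreover have "2 * M * D t ^ 3 < 0" using d M3 by (simp add: mult_pos_neg)
    ultimately show ?thesis by (metis mult_neg_pos not_le)
  next
    case False
    then have d: "D t > 0" and "cos (M * t) \<le> 0" using D_pos cos_M_nonpos assms tp by auto
    then have "0 \<le> (4 * s\<^sup>2 * cos t * lobe_num t) * (- cos (M * t)) + 2 * s\<^sup>2 * sin t * (D t) * (cos (M * t))\<^sup>2"
      using s by (intro add_nonneg_nonneg mult_nonneg_nonneg[OF N] mult_nonneg_nonneg) auto
    then have "2 * M * D t ^ 3 * X' t \<le> 0" unfolding D_X' by (simp add: algebra_simps)
    moreover have "2 * M * D t ^ 3 > 0" using d M3 by simp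
    ultimately show ?thesis by (metis mult_pos_pos not_le)
  qed
qed

text \<open>
  In the formula \<open>D_Y'\<close> only the term with \<open>sin (2 M t)\<close> can have the wrong sign. Up to \<open>3 \<theta>\<close> its
  sign is right, because \<open>2 M t\<close> lies between \<open>2 \<pi>\<close> and \<open>3 \<pi>\<close>. Beyond \<open>3 \<theta>\<close> the quantity
  \<open>D\<close> exceeds \<open>4 s\<^sup>2\<close>, and the crude bounds \<open>\<bar>sin (2 M t)\<bar> \<le> 2 M cos t\<close> and \<open>1 \<le> M s\<close> show that the
  term \<open>M D\<^sup>2 cos t\<close> dominates.
\<close>
lemma Y'_nonpos:
  assumes "2 * \<theta> < t" "t < pi/2" shows "Y' t \<le> 0"
proof -
  have st: "0 < sin t" "0 < cos t" using assms theta_pos by (auto intro!: sin_gt_zero cos_gt_zero)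
  have d: "0 < D t" using assms D_pos theta_pos by simp
  let ?R = "M * cos t * (D t)\<^sup>2 + 4 * M * s\<^sup>2 * cos t * D t * (sin (M * t))\<^sup>2
     + s\<^sup>2 * sin t * sin (2 * M * t) * (D t + 4 * (cos t)\<^sup>2)"
  have "0 \<le> ?R"
  proof (cases "t \<le> 3 * \<theta>")
    case True
    have "2 * (M * (2 * \<theta>)) \<le> 2 * (M * t)" "2 * (M * t) \<le> 2 * (M * (3 * \<theta>))"
      using assms True M3 by (auto intro!: mult_left_mono)
    then have "0 \<le> sin (2 * M * t - 2 * pi)" using M_theta by (intro sin_ge_zero) auto
    then have "0 \<le> sin (2 * M * t)" by (simp add: sin_diff)
    then show ?thesis using st d M3 by (intro add_nonneg_nonneg mult_nonneg_nonneg) auto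
  next
    case False
    have M4: "4 \<le> M"
    proof (rule ccontr)
      assume "\<not> 4 \<le> M"
      then have "N < 3" unfolding M_def by linarith
      then have "M = 3" using N2 by (simp add: M_def)
      then show False using M_theta False assms by simp
    qed
    have th8: "\<theta> \<le> 2/5"
    proof -
      have "4 * \<theta> \<le> M * \<theta>" using M4 theta_pos by (intro mult_right_mono) auto
      moreover have "pi \<le> 3.2" using pi_approx by simp
      ultimately show ?thesis using M_theta by linarith
    qed
    have s_le: "s \<le> 2/5" unfolding s_def using sin_x_le_x[of \<theta>] theta_pos th8 by linarith
    have s2: "s\<^sup>2 \<le> 4/25" using power_mono[OF s_le, of 2] s_pos by (simp add: power2_eq_square)
    define \<kappa> where "\<kappa> = sin t / s"
    have k: "sin t = \<kappa> * s" using s_pos by (simp add: \<kappa>_def)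
    \<comment> \<open>The value \<open>23/10\<close> is a rounded lower bound of \<open>sin (3 \<theta>) / sin \<theta> = 3 - 4 s\<^sup>2\<close> for \<open>M \<ge> 4\<close>.\<close>
    have k23: "23/10 \<le> \<kappa>"
    proof -
      have "sin (3 * \<theta>) \<le> sin t" using False assms theta_pos by (subst sin_mono_le_eq) auto
      moreover have "sin (3 * \<theta>) = (3 - 4 * s\<^sup>2) * s"
      proof -
        have "sin (3 * \<theta>) = sin (2 * \<theta> + \<theta>)" by simp
        also have "\<dots> = 2 * s * (cos \<theta>)\<^sup>2 + (1 - 2 * s\<^sup>2) * s"
          unfolding sin_add sin_double cos_double_sin s_def by (simp add: power2_eq_square)
        finally show ?thesis unfolding cos_squared_eq s_def by (simp add: algebra_simps)
      qed
      ultimately have "(3 - 4 * s\<^sup>2) * s \<le> \<kappa> * s" using k by simp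
      then have "3 - 4 * s\<^sup>2 \<le> \<kappa>" using s_pos by simp
      then show ?thesis using s2 by simp
    qed
    have Jordan: "1 \<le> M * s"
    proof -
      have r: "real (N + 1) = M" by (simp add: M_def)
      show ?thesis using abs_sin_mult_le[of "N+1" \<theta>] s_pos unfolding r M_theta by (simp add: s_def)
    qed
    have sl: "\<bar>sin (2 * M * t)\<bar> \<le> 2 * M * cos t" 
    proof -
      have "sin (real (2 * (N+1)) * (pi/2 - t)) = sin (real (N+1) * pi - 2 * M * t)"
        by (simp add: M_def algebra_simps)
      also have "\<bar>\<dots>\<bar> = \<bar>sin (2 * M * t)\<bar>"
        unfolding sin_diff sin_npi cos_npi by (simp add: abs_mult)
      finally show ?thesis using abs_sin_mult_le[of "2 * (N+1)" "pi/2 - t"] st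
        by (simp add: M_def cos_sin_eq algebra_simps)
    qed
    have De: "D t = (\<kappa>\<^sup>2 - 1) * s\<^sup>2" unfolding D_def k by (simp add: algebra_simps power2_eq_square)
    have A: "s\<^sup>2 * sin t * \<bar>sin (2 * M * t)\<bar> * D t \<le> s\<^sup>2 * 1 * (2 * M * cos t) * D t"
      using sl st d by (intro mult_right_mono mult_mono) auto
    have B: "s\<^sup>2 * sin t * \<bar>sin (2 * M * t)\<bar> * (4 * (cos t)\<^sup>2) \<le> s\<^sup>2 * sin t * (M * s) * (4 * cos t)"
    proof -
      have "\<bar>sin (2 * M * t)\<bar> \<le> M * s" using Jordan by (rule order_trans[OF abs_sin_le_one])
      moreover have "(cos t)\<^sup>2 \<le> cos t" using st by (simp add: power2_eq_square mult_left_le)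
      ultimately show ?thesis using st s_pos M3 by (intro mult_mono mult_left_mono mult_nonneg_nonneg) auto
    qed
    have "4 * \<kappa> \<le> (\<kappa>\<^sup>2 - 3) * (\<kappa>\<^sup>2 - 1)"
    proof -
      have k1: "23/10 * \<kappa> \<le> \<kappa>\<^sup>2" using k23 by (simp add: power2_eq_square)
      then have k2: "529/100 \<le> \<kappa>\<^sup>2" using mult_mono[OF k23 k23] k23 by (simp add: power2_eq_square)
      have "229/100 * (23/10 * \<kappa> - 1) \<le> (\<kappa>\<^sup>2 - 3) * (\<kappa>\<^sup>2 - 1)"
        using k1 k2 k23 by (intro mult_mono) auto
      moreover have "4 * \<kappa> \<le> 229/100 * (23/10 * \<kappa> - 1)" using k23 by simp
      ultimately show ?thesis by (rule order_trans[rotated])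
    qed
    then have "M * cos t * s ^ 4 * (4 * \<kappa>) \<le> M * cos t * s ^ 4 * ((\<kappa>\<^sup>2 - 3) * (\<kappa>\<^sup>2 - 1))"
      using M3 st by (intro mult_left_mono) auto
    then have C: "s\<^sup>2 * 1 * (2 * M * cos t) * D t + s\<^sup>2 * sin t * (M * s) * (4 * cos t) \<le> M * cos t * (D t)\<^sup>2"
      unfolding De k by (simp add: algebra_simps power2_eq_square power4_eq_xxxx)
    have "- (s\<^sup>2 * sin t * \<bar>sin (2 * M * t)\<bar> * (D t + 4 * (cos t)\<^sup>2)) \<le> s\<^sup>2 * sin t * sin (2 * M * t) * (D t + 4 * (cos t)\<^sup>2)"
    proof -
      have "(s\<^sup>2 * sin t * (D t + 4 * (cos t)\<^sup>2)) * (- \<bar>sin (2 * M * t)\<bar>) \<le> (s\<^sup>2 * sin t * (D t + 4 * (cos t)\<^sup>2)) * sin (2 * M * t)"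
        using st d by (intro mult_left_mono) auto
      then show ?thesis by (simp add: algebra_simps)
    qed
    moreover have "0 \<le> 4 * M * s\<^sup>2 * cos t * D t * (sin (M * t))\<^sup>2"
      using st d M3 by simp
    ultimately show ?thesis using A B C unfolding distrib_left by linarith
  qed
  then have "2 * M * D t ^ 3 * Y' t \<le> 0" using D_Y'[of t] by linarith
  moreover have "2 * M * D t ^ 3 > 0" using d M3 by simp
  ultimately show ?thesis by (metis mult_pos_pos not_le)
qed

text \<open>
  Where \<open>D\<close> vanishes, \<open>D_X\<close> gives no information and the sign is obtained by continuity.
\<close>
lemma X_nonneg:
  assumes "\<bar>t\<bar> \<le> pi/2" shows "0 \<le> X t"
proof -
  have ae: "0 \<le> X u" if "\<bar>u\<bar> \<le> pi/2" "D u \<noteq> 0" for u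
  proof -
    have "0 \<le> cos u" using that by (intro cos_ge_zero) auto
    then have "0 \<le> 2 * M * (D u)\<^sup>2 * X u" unfolding D_X by simp
    moreover have "0 < 2 * M * (D u)\<^sup>2" using M3 that by simp
    ultimately show ?thesis by (simp add: zero_le_mult_iff)
  qed
  show ?thesis
  proof (cases "D t = 0")
    case False
    then show ?thesis using ae assms by simp
  next
    case True
    have tlt: "\<bar>t\<bar> < pi/2"
    proof (rule ccontr)
      assume "\<not> ?thesis"
      then have "\<bar>t\<bar> = pi/2" using assms by simp
      then have "D \<bar>t\<bar> > 0" using D_pos[of "\<bar>t\<bar>"] theta_le theta_pos by simp
      then show False using True by (cases "t \<ge> 0") (auto simp: D_def)
    qed
    have "(X \<longlongrightarrow> X t) (at t)"
      using X_deriv DERIV_isCont isCont_def by blast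
    moreover have "\<forall>\<^sub>F u in at t. 0 \<le> X u"
    proof -
      have f: "finite ({\<theta>, -\<theta>} - {t})" by simp
      have "\<forall>\<^sub>F u in at t. u \<in> {-(pi/2)<..<pi/2} - ({\<theta>, -\<theta>} - {t})"
        using tlt by (intro eventually_at_in_open' open_Diff finite_imp_closed[OF f]) auto
      moreover have "\<forall>\<^sub>F u in at t. u \<noteq> t" by (simp add: eventually_at_filter)
      ultimately show ?thesis
      proof eventually_elim
        case (elim u)
        then have "\<bar>u\<bar> < \<theta> \<or> \<theta> < \<bar>u\<bar>" by auto
        moreover have "\<bar>u\<bar> \<le> pi/2" using elim(1) by (auto simp: abs_le_iff)
        ultimately have "D \<bar>u\<bar> \<noteq> 0" using D_pos[of "\<bar>u\<bar>"] D_neg[of "\<bar>u\<bar>"] elim by auto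
        then have "D u \<noteq> 0" by (cases "u \<ge> 0") (auto simp: D_def)
        then show ?case using ae elim by auto
      qed
    qed
    ultimately show ?thesis by (intro tendsto_lowerbound) auto
  qed
qed

end

section \<open>Holomorphic functions with positive real part\<close>

lemma Re_pos_of_nonneg:
  assumes "f holomorphic_on S" "open S" "connected S" "\<not> f constant_on S"
    and "\<And>z. z \<in> S \<Longrightarrow> 0 \<le> Re (f z)" and "z \<in> S"
  shows "0 < Re (f z)"
proof (rule ccontr)
  assume "\<not> ?thesis"
  then have z: "Re (f z) = 0" using assms(5)[OF assms(6)] by simp
  have "open (f ` S)" using open_mapping_thm[OF assms(1,2,3,2) _ assms(4)] by simp
  then obtain e where e: "e > 0" "ball (f z) e \<subseteq> f ` S"
    using assms(6) by (meson image_eqI open_contains_ball)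
  have "f z - of_real (e/2) \<in> f ` S" using e by (intro subsetD[OF e(2)]) (simp add: dist_norm)
  then obtain u where "u \<in> S" "f u = f z - of_real (e/2)" by auto
  then show False using assms(5)[of u] z e(1) by simp
qed

text \<open>
  Minimum principle for the real part. Exceptional boundary points are allowed since boundary
  values are often computed by formulas that degenerate at some points.
\<close>
lemma Re_ge_on_ball:
  assumes hol: "g holomorphic_on ball 0 1" and cont: "continuous_on (cball 0 1) g"
    and E: "finite E" and bd: "\<And>w. norm w = 1 \<Longrightarrow> w \<notin> E \<Longrightarrow> c \<le> Re (g w)"
    and w: "norm w < 1"
  shows "c \<le> Re (g w)"
proof -
  have sph: "c \<le> Re (g u)" if u: "norm u = 1" for u
  proof -
    have "u islimpt sphere 0 1"
    proof (rule connected_imp_perfect)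
      show "connected (sphere (0::complex) 1)" by (rule connected_sphere) simp
      show "u \<in> sphere 0 1" using u by simp
      show "sphere (0::complex) 1 \<noteq> {v}" for v :: complex
      proof
        assume "sphere (0::complex) 1 = {v}"
        moreover have "1 \<in> sphere (0::complex) 1" "-1 \<in> sphere (0::complex) 1" by auto
        ultimately show False by auto
      qed
    qed
    then have "u islimpt (sphere 0 1 - E)"
      using islimpt_Un_finite[of "sphere 0 1 \<inter> E" u "sphere 0 1 - E"] E by (simp add: Int_Diff_Un)
    then have nt: "at u within (sphere 0 1 - E) \<noteq> bot" by (simp add: trivial_limit_within)
    have "continuous_on (sphere 0 1) g" using cont by (rule continuous_on_subset) auto
    then have "(g \<longlongrightarrow> g u) (at u within (sphere 0 1 - E))"
      using u by (metis Diff_subset continuous_on_def mem_sphere_0 tendsto_within_subset)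
    then have "((\<lambda>x. Re (g x)) \<longlongrightarrow> Re (g u)) (at u within (sphere 0 1 - E))"
      by (rule tendsto_Re)
    moreover have "\<forall>\<^sub>F x in at u within (sphere 0 1 - E). c \<le> Re (g x)"
      using bd by (auto simp: eventually_at_filter)
    ultimately show ?thesis using nt by (intro tendsto_lowerbound)
  qed
  have "Re (- g w) \<le> - c"
  proof (rule maximum_real_frontier[of "\<lambda>w. - g w" "ball 0 1"])
    show "(\<lambda>w. - g w) holomorphic_on interior (ball 0 1)" using hol by (auto intro: holomorphic_intros)
    show "continuous_on (closure (ball 0 1)) (\<lambda>w. - g w)" using cont by (auto intro: continuous_intros)
    show "Re (- g z) \<le> - c" if "z \<in> frontier (ball 0 1)" for z
      using sph that by (simp add: frontier_ball)
  qed (use w in auto)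
  then show ?thesis by simp
qed

lemma Re_inverse_one_plus: "norm w \<le> 1 \<Longrightarrow> w \<noteq> -1 \<Longrightarrow> 1 / 2 \<le> Re (1 / (1 + w))"
proof -
  assume w: "norm w \<le> 1" "w \<noteq> -1"
  have n: "norm (1 + w) ^ 2 > 0" using w by (auto simp: add_eq_0_iff)
  have "(Re w)\<^sup>2 + (Im w)\<^sup>2 \<le> 1" using w(1) cmod_power2[of w] by (metis abs_norm_cancel abs_square_le_1)
  then have "norm (1 + w) ^ 2 \<le> 2 * Re (1 + w)"
    unfolding cmod_power2 by (simp add: power2_eq_square algebra_simps)
  then show ?thesis using n unfolding Re_divide cmod_power2[symmetric]
    by (simp add: cmod_power2 field_simps)
qed

lemma Re_inverse_one_plus_circle: 
  assumes "norm w = 1" "w \<noteq> -1" shows "Re (1 / (1 + w)) = 1 / 2"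
proof -
  have n: "norm (1 + w) ^ 2 > 0" using assms by (auto simp: add_eq_0_iff)
  have "(Re w)\<^sup>2 + (Im w)\<^sup>2 = 1" using assms(1) cmod_power2[of w] by simp
  then have "norm (1 + w) ^ 2 = 2 * Re (1 + w)"
    unfolding cmod_power2 by (simp add: power2_eq_square algebra_simps)
  then show ?thesis using n unfolding Re_divide cmod_power2[symmetric]
    by (simp add: cmod_power2 field_simps)
qed

text \<open>
  A simple pole at the boundary point \<open>-1\<close> with a nonnegative coefficient \<open>c\<close>. On the unit circle
  \<open>Re (1 / (1 + w))\<close> is constantly \<open>1/2\<close>. So after the polar part \<open>c / (1 + w)\<close> is subtracted, the
  minimum principle gives the bound \<open>- c / 2\<close>, and inside the disc the polar part contributes
  at least \<open>c / 2\<close>.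
\<close>
lemma Re_nonneg_simple_pole:
  assumes hol: "h holomorphic_on ball 0 1" and cont: "continuous_on (cball 0 1) h"
    and der: "(h has_field_derivative h') (at (-1))"
    and c: "h (-1) = of_real c" "0 \<le> c"
    and E: "finite E" and bd: "\<And>w. norm w = 1 \<Longrightarrow> w \<notin> E \<Longrightarrow> w \<noteq> -1 \<Longrightarrow> 0 \<le> Re (h w / (1 + w))"
    and w: "norm w < 1"
  shows "0 \<le> Re (h w / (1 + w))"
proof -
  define g where "g w = (if w = -1 then h' else (h w - of_real c) / (1 + w))" for w
  have g: "g w = h w / (1 + w) - of_real c * (1 / (1 + w))" if "w \<noteq> -1" for w
    using that by (simp add: g_def diff_divide_distrib)
  have Re_g: "Re (g w) = Re (h w / (1 + w)) - c * Re (1 / (1 + w))" if "w \<noteq> -1" for w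
    unfolding g[OF that] minus_complex.sel Re_complex_of_real Im_complex_of_real times_complex.sel
    by (simp only: mult_zero_left diff_zero)
  have ne: "norm w < 1 \<Longrightarrow> 1 + w \<noteq> 0" for w :: complex
    by (metis add_eq_0_iff norm_minus_cancel norm_one less_irrefl)
  have "- c / 2 \<le> Re (g w)"
  proof (rule Re_ge_on_ball[of g "insert (-1) E"])
    have "(\<lambda>w. (h w - of_real c) / (1 + w)) holomorphic_on ball 0 1"
      using ne by (intro holomorphic_intros hol) auto
    then show "g holomorphic_on ball 0 1"
      by (rule holomorphic_transform) (auto simp: g_def)
    show "continuous_on (cball 0 1) g"
    proof (rule continuous_on_eq_continuous_within[THEN iffD2], rule ballI)
      fix z :: complex assume z: "z \<in> cball 0 1"
      show "continuous (at z within cball 0 1) g"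
      proof (cases "z = -1")
        case True
        have "((\<lambda>w. (h w - h (-1)) / (w - (-1))) \<longlongrightarrow> h') (at (-1))"
          using der has_field_derivative_iff by blast
        then have "(g \<longlongrightarrow> h') (at (-1))"
          by (rule Lim_transform_eventually) (auto simp: eventually_at_filter g_def c add.commute)
        then have "(g \<longlongrightarrow> g (-1)) (at (-1))" by (simp add: g_def)
        then show ?thesis unfolding continuous_within True by (rule tendsto_within_subset) simp
      next
        case False
        have "continuous (at z within cball 0 1) (\<lambda>w. (h w - of_real c) / (1 + w))"
          using cont z False
          by (intro continuous_intros) (auto simp: continuous_on_eq_continuous_within add_eq_0_iff)
        then show ?thesis
        proof (rule continuous_transform_within[where \<delta> = "dist z (-1)"])
          show "0 < dist z (-1)" using False by simp
        qed (use z in \<open>auto simp: g_def dist_commute\<close>)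
      qed
    qed
    show "- c / 2 \<le> Re (g w)" if "norm w = 1" "w \<notin> insert (-1) E" for w
      using that bd[of w] by (simp add: Re_g Re_inverse_one_plus_circle)
  qed (use E w in auto)
  moreover have "c * (1/2) \<le> c * Re (1 / (1 + w))"
    using w c ne by (intro mult_left_mono Re_inverse_one_plus) auto
  moreover have "w \<noteq> -1" using w by auto
  ultimately show ?thesis using Re_g[of w] by linarith
qed

text \<open>
  Noshiro--Warschawski criterion: along the segment from \<open>u\<close> to \<open>u + d\<close> the real part of \<open>(f \<circ> p) / d\<close>
  has derivative \<open>Re (f \<circ> p)' > 0\<close>. The convex domain \<open>T\<close> enters through a parametrization \<open>p\<close> of \<open>S\<close>, so that
  \<open>S\<close> itself need not be convex.
\<close>
lemma inj_on_of_Re_deriv_pos: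
  assumes T: "convex T" and q: "S \<subseteq> p ` T" "p ` T \<subseteq> S"
    and der: "\<And>\<zeta>. \<zeta> \<in> T \<Longrightarrow> \<exists>d. ((\<lambda>\<zeta>. f (p \<zeta>)) has_field_derivative d) (at \<zeta>) \<and> 0 < Re d"
  shows "inj_on f S"
proof (rule inj_onI, rule ccontr)
  fix x y assume x: "x \<in> S" and y: "y \<in> S" and eq: "f x = f y" and ne: "x \<noteq> y"
  obtain u v where u: "u \<in> T" "x = p u" and v: "v \<in> T" "y = p v" using q x y by blast
  define d where "d = v - u"
  have d: "d \<noteq> 0" using ne u v by (auto simp: d_def)
  let ?G = "\<lambda>r. Re (f (p (u + of_real r * d)) / d)"
  have "?G 0 < ?G 1"
  proof (rule DERIV_pos_imp_increasing[of 0 1 ?G])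
    fix r :: real assume r: "0 \<le> r" "r \<le> 1"
    have "u + of_real r * d = (1 - r) *\<^sub>R u + r *\<^sub>R v"
      by (simp add: d_def scaleR_conv_of_real algebra_simps)
    then have "u + of_real r * d \<in> T" using T u v r by (simp add: convexD_alt)
    then obtain e where e: "((\<lambda>\<zeta>. f (p \<zeta>)) has_field_derivative e) (at (u + of_real r * d))" "0 < Re e"
      using der by blast
    have "((\<lambda>r. u + r * d) has_field_derivative d) (at (of_real r))"
      by (auto intro!: derivative_eq_intros)
    from DERIV_chain2[OF e(1) this]
    have "((\<lambda>r. f (p (u + r * d)) / d) has_field_derivative e * d / d) (at (of_real r))"
      by (rule DERIV_cdivide)
    then have "((\<lambda>r. f (p (u + r * d)) / d) has_field_derivative e) (at (of_real r))" using d by simp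
    then have "((\<lambda>r. f (p (u + of_real r * d)) / d) has_vector_derivative e) (at r)"
      by (rule has_vector_derivative_real_field)
    then have "(?G has_real_derivative Re e) (at r)"
      by (auto dest!: has_field_derivative_Re)
    then show "\<exists>y. (?G has_real_derivative y) (at r) \<and> 0 < y" using e(2) by blast
  qed simp
  then show False using eq u v by (simp add: d_def)
qed

text \<open>
  Two continuous square roots of the same nonvanishing function agree on a connected set if they
  agree at one point: their quotient only takes the values \<open>1\<close> and \<open>-1\<close>.
\<close>
lemma eq_if_squares_eq:
  fixes f g :: "complex \<Rightarrow> complex"
  assumes "connected S" "continuous_on S f" "continuous_on S g"
    and "\<And>z. z \<in> S \<Longrightarrow> f z ^ 2 = g z ^ 2" "\<And>z. z \<in> S \<Longrightarrow> g z \<noteq> 0"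
    and "z0 \<in> S" "f z0 = g z0" "z \<in> S"
  shows "f z = g z"
proof -
  have "(\<lambda>z. f z / g z) constant_on S"
  proof (rule continuous_finite_range_constant)
    show "continuous_on S (\<lambda>z. f z / g z)" using assms by (intro continuous_intros) auto
    have "(\<lambda>z. f z / g z) ` S \<subseteq> {1, -1}"
    proof (rule image_subsetI)
      fix z assume z: "z \<in> S"
      then have "f z = g z \<or> f z = - g z" using assms(4) power2_eq_iff by blast
      then show "f z / g z \<in> {1, -1}" using assms(5)[OF z] by auto
    qed
    then show "finite ((\<lambda>z. f z / g z) ` S)" by (rule finite_subset) simp
  qed (rule assms(1))
  then have "f z / g z = f z0 / g z0" using assms(6,8) unfolding constant_on_def by metis
  then show ?thesis using assms by simp
qed

section \<open>The derivative of the polynomial in the strip coordinate\<close>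

lemma isCont_csqrt_right:
  assumes "0 < Re z \<or> z = 0" shows "isCont csqrt z"
proof (cases "z = 0")
  case True
  have "((\<lambda>z::complex. sqrt (norm z)) \<longlongrightarrow> sqrt (norm (0::complex))) (at 0)"
    by (rule tendsto_real_sqrt[OF tendsto_norm[OF tendsto_ident_at]])
  then have "((\<lambda>z. norm (csqrt z)) \<longlongrightarrow> 0) (at 0)"
    unfolding norm_csqrt norm_zero real_sqrt_zero .
  then have "(csqrt \<longlongrightarrow> 0) (at 0)"
    by (rule tendsto_norm_zero_cancel)
  then show ?thesis by (simp add: True isCont_def)
next
  case False
  then have "z \<notin> \<real>\<^sub>\<le>\<^sub>0" using assms by (auto simp: complex_nonpos_Reals_iff)
  then show ?thesis by (rule continuous_at_csqrt)
qed

lemma one_minus_unit_disc: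
  assumes "norm w \<le> 1" "norm c = 1" shows "0 < Re (1 - w * c) \<or> 1 - w * c = 0"
proof -
  have n: "norm (w * c) \<le> 1" using assms by (simp add: norm_mult)
  then have r: "Re (w * c) \<le> 1" using complex_Re_le_cmod order_trans by blast
  show ?thesis
  proof (cases "Re (w * c) = 1")
    case True
    then have "(Im (w * c))\<^sup>2 \<le> 0" using n cmod_power2[of "w * c"] power_mono[OF n, of 2] by simp
    then have "w * c = 1" using True by (intro complex_eqI) auto
    then show ?thesis by simp
  qed (use r in simp)
qed

lemma csqrt_cnj_right:
  assumes "0 < Re u \<or> u = 0" shows "csqrt (cnj u) = cnj (csqrt u)"
  using assms cnj_csqrt[of u] by (cases "u = 0") (auto simp: complex_nonpos_Reals_iff)

text \<open>
  Both formulas come from \<open>1 - e\<^sup>2\<^sup>i\<^sup>x = 2 sin x e\<^sup>i\<^sup>(\<^sup>x\<^sup>-\<^sup>\<pi>\<^sup>/\<^sup>2\<^sup>)\<close> and its conjugate.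
\<close>
lemma csqrt_one_minus_cis:
  assumes "0 < x" "x < pi"
  shows "csqrt (1 - cis (2 * x)) = of_real (sqrt (2 * sin x)) * cis (x / 2 - pi / 4)"
    and "csqrt (1 - cis (- (2 * x))) = of_real (sqrt (2 * sin x)) * cis (pi / 4 - x / 2)"
proof -
  have s: "0 < sin x" using assms by (rule sin_gt_zero)
  have c: "0 < cos (x / 2 - pi / 4)" using assms by (intro cos_gt_zero_pi) auto
  have c': "0 < cos (pi / 4 - x / 2)" using assms by (intro cos_gt_zero_pi) auto
  have sq: "(of_real (sqrt (2 * sin x)) * cis y)\<^sup>2 = of_real (2 * sin x) * cis (2 * y)" for y
    using s by (simp add: power_mult_distrib Complex.DeMoivre flip: of_real_power)
  have dc: "1 - cos (2 * x) = 2 * sin x * sin x" by (simp add: cos_double_sin power2_eq_square)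
  show "csqrt (1 - cis (2 * x)) = of_real (sqrt (2 * sin x)) * cis (x / 2 - pi / 4)"
  proof (rule csqrt_unique)
    have "cis (2 * (x / 2 - pi / 4)) = cis (x - pi / 2)" by (simp add: algebra_simps)
    then show "(of_real (sqrt (2 * sin x)) * cis (x / 2 - pi / 4))\<^sup>2 = 1 - cis (2 * x)"
      unfolding sq using dc by (simp add: complex_eq_iff sin_diff cos_diff sin_double)
  qed (use s c in simp)
  show "csqrt (1 - cis (- (2 * x))) = of_real (sqrt (2 * sin x)) * cis (pi / 4 - x / 2)"
  proof (rule csqrt_unique)
    have "cis (2 * (pi / 4 - x / 2)) = cis (pi / 2 - x)" by (simp add: algebra_simps)
    then show "(of_real (sqrt (2 * sin x)) * cis (pi / 4 - x / 2))\<^sup>2 = 1 - cis (- (2 * x))"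
      unfolding sq using dc by (simp add: complex_eq_iff sin_diff cos_diff sin_double)
  qed (use s c' in simp)
qed

context cheb_param begin

text \<open>
  Since \<open>F\<close> is odd, \<open>F' z\<close> is a polynomial in \<open>w = z\<^sup>2\<close>; this polynomial is \<open>dF\<close>.
\<close>
definition dF :: "complex \<Rightarrow> complex" where
  "dF w = (\<Sum>j=1..N. of_real (a j * real (2 * j - 1)) * w ^ (j - 1))"
text \<open>
  The square root of \<open>(1 - w)\<^sup>2 + 4 w sin\<^sup>2 (2 \<theta>)\<close> with value \<open>1\<close> at \<open>0\<close>. The radicand factors over its
  zeros \<open>e\<^sup>\<plusminus>\<^sup>4\<^sup>i\<^sup>\<theta>\<close>. Away from its zero each factor has positive real part on the closed
  unit disc, so its principal square root is holomorphic inside and continuous up to the boundary.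
\<close>
definition Q :: "complex \<Rightarrow> complex" where
  "Q w = csqrt (1 - w * cis (2 * (2 * \<theta>))) * csqrt (1 - w * cis (- (2 * (2 * \<theta>))))"
definition h :: "complex \<Rightarrow> complex" where "h w = dF w * (1 - w) * Q w"

lemma F0_deriv: "(F0 N has_field_derivative dF (z\<^sup>2)) (at z)"
proof -
  have e: "z ^ (2 * j - 1 - 1) = (z\<^sup>2) ^ (j - 1)" for j
    by (metis diff_diff_left mult_1_right one_add_one power_mult right_diff_distrib')
  have "((\<lambda>z. \<Sum>j=1..N. of_real (a j) * z ^ (2 * j - 1)) has_field_derivative
     (\<Sum>j=1..N. of_real (a j) * (of_nat (2 * j - 1) * z ^ (2 * j - 1 - 1)))) (at z)"
    by (auto intro!: derivative_eq_intros sum.cong)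
  then show ?thesis unfolding F0_a[abs_def] dF_def e by (simp add: mult.assoc)
qed

lemma dF_cis: "cis t * dF (cis (2 * t)) = Complex (Y' t) (- X' t)"
proof -
  have "cis t * dF (cis (2 * t)) = (\<Sum>j=1..N. of_real (a j * real (2*j-1)) * cis (real (2*j-1) * t))"
    unfolding dF_def sum_distrib_left
  proof (rule sum.cong[OF refl])
    fix j assume "j \<in> {1..N}"
    then have r: "real (2*j-1) * t = t + real (j - 1) * (2 * t)" by (simp add: of_nat_diff algebra_simps)
    show "cis t * (of_real (a j * real (2*j-1)) * cis (2 * t) ^ (j - 1))
       = of_real (a j * real (2*j-1)) * cis (real (2*j-1) * t)"
      unfolding r cis_mult[symmetric] Complex.DeMoivre by (simp add: mult_ac)
  qed
  then show ?thesis
    by (intro complex_eqI) (simp_all add: Y'_def X'_def sum_negf[symmetric])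
qed

lemma dF_cnj: "dF (cnj w) = cnj (dF w)" by (simp add: dF_def)

lemma csqrt_cnj: assumes "norm w \<le> 1" "norm c = 1"
  shows "csqrt (1 - cnj w * cnj c) = cnj (csqrt (1 - w * c))"
proof -
  have "csqrt (cnj (1 - w * c)) = cnj (csqrt (1 - w * c))"
    using one_minus_unit_disc[OF assms] by (rule csqrt_cnj_right)
  then show ?thesis by simp
qed

lemma Q_cnj: "norm w \<le> 1 \<Longrightarrow> Q (cnj w) = cnj (Q w)"
  using csqrt_cnj[of w "cis (2 * (2 * \<theta>))"] csqrt_cnj[of w "cis (- (2 * (2 * \<theta>)))"]
  by (simp add: Q_def cis_cnj)

lemma Q_of_real: "\<bar>x\<bar> \<le> 1 \<Longrightarrow> Q (of_real x) = of_real (norm (1 - of_real x * cis (2 * (2 * \<theta>))))"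
proof -
  assume x: "\<bar>x\<bar> \<le> 1"
  let ?r = "csqrt (1 - of_real x * cis (2 * (2 * \<theta>)))"
  have "Q (of_real x) = ?r * cnj ?r"
    using csqrt_cnj[of "of_real x" "cis (2 * (2 * \<theta>))"] x by (simp add: Q_def cis_cnj)
  also have "\<dots> = of_real ((norm ?r)\<^sup>2)" by (simp only: complex_norm_square)
  finally show ?thesis by simp
qed

lemma h_cnj: "norm w \<le> 1 \<Longrightarrow> h (cnj w) = cnj (h w)"
  by (simp add: h_def dF_cnj Q_cnj)

lemma Q_squared: "Q w ^ 2 = (1 - w)\<^sup>2 + 4 * of_real ((sin (2 * \<theta>))\<^sup>2) * w"
proof -
  have p: "cis (2 * (2 * \<theta>)) * cis (- (2 * (2 * \<theta>))) = 1" by (simp add: cis_mult)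
  have q: "cis (2 * (2 * \<theta>)) + cis (- (2 * (2 * \<theta>))) = 2 - 4 * of_real ((sin (2 * \<theta>))\<^sup>2)"
    by (simp only: complex_eq_iff cos_double_sin[of "2*\<theta>"] plus_complex.sel minus_complex.sel cis.sel cos_minus sin_minus) simp
  have "Q w ^ 2 = (1 - w * cis (2 * (2 * \<theta>))) * (1 - w * cis (- (2 * (2 * \<theta>))))"
    by (simp add: Q_def power_mult_distrib)
  also have "\<dots> = 1 - w * (cis (2 * (2 * \<theta>)) + cis (- (2 * (2 * \<theta>))))
     + w\<^sup>2 * (cis (2 * (2 * \<theta>)) * cis (- (2 * (2 * \<theta>))))"
    by (simp add: algebra_simps power2_eq_square)
  also have "\<dots> = (1 - w)\<^sup>2 + 4 * of_real ((sin (2 * \<theta>))\<^sup>2) * w"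
    unfolding p q by (simp add: algebra_simps power2_eq_square)
  finally show ?thesis .
qed

lemma Q_nonzero: assumes "norm w < 1" shows "Q w \<noteq> 0"
proof -
  have "1 - w * c \<noteq> 0" if "norm c = 1" for c
  proof
    assume "1 - w * c = 0"
    then have "norm (w * c) = 1" by simp
    then show False using assms that by (simp add: norm_mult)
  qed
  then show ?thesis by (simp add: Q_def)
qed

text \<open>
  On the circle, with \<open>w = e\<^sup>2\<^sup>i\<^sup>t\<close>, the factor \<open>(1 - w) / (1 + w)\<close> equals \<open>- i tan t\<close>, and \<open>Q w\<close> is a nonnegative
  multiple of \<open>e\<^sup>i\<^sup>t\<close> for \<open>t < 2 \<theta>\<close> and of \<open>- i e\<^sup>i\<^sup>t\<close> for \<open>t > 2 \<theta>\<close>. So the real part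
  selects \<open>- X'\<close> on the first arc and \<open>- Y'\<close> on the second one.
\<close>
lemma h_boundary:
  assumes "0 < t" "t < pi / 2" "t \<noteq> \<theta>" "t \<noteq> 2 * \<theta>"
  shows "0 \<le> Re (h (cis (2 * t)) / (1 + cis (2 * t)))"
proof -
  have st: "0 < sin t" "0 < cos t" using assms by (auto intro!: sin_gt_zero cos_gt_zero)
  have dF: "dF (cis (2 * t)) = cis (- t) * Complex (Y' t) (- X' t)"
    unfolding dF_cis[symmetric] by (simp add: mult.assoc[symmetric] cis_mult)
  have m: "1 - cis (2 * t) = - 2 * \<i> * of_real (sin t) * cis t"
    by (simp add: complex_eq_iff cos_double_sin sin_double power2_eq_square)
  have p: "1 + cis (2 * t) = 2 * of_real (cos t) * cis t"
    by (simp add: complex_eq_iff cos_double_cos sin_double power2_eq_square)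
  have r: "(1 - cis (2 * t)) / (1 + cis (2 * t)) = - \<i> * of_real (tan t)"
    unfolding m p using st by (simp add: tan_def divide_simps)
  have H: "h (cis (2 * t)) / (1 + cis (2 * t))
      = Complex (Y' t) (- X' t) * (- \<i> * of_real (tan t)) * (cis (- t) * Q (cis (2 * t)))"
    unfolding h_def r[symmetric] dF by simp
  define q where "q = sqrt (2 * sin (t + 2 * \<theta>)) * sqrt (2 * sin \<bar>t - 2 * \<theta>\<bar>)"
  have tt: "0 < t + 2 * \<theta>" "t + 2 * \<theta> < pi" using assms theta_le theta_pos by auto
  have "0 \<le> sin (t + 2 * \<theta>)" using tt by (intro sin_ge_zero) auto
  moreover have "0 \<le> sin \<bar>t - 2 * \<theta>\<bar>" using assms theta_le theta_pos by (intro sin_ge_zero) (auto simp: abs_if)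
  ultimately have q: "0 \<le> q" by (simp add: q_def)
  have tan: "0 \<le> tan t" using st by (simp add: tan_def)
  have e1: "cis (2 * t) * cis (2 * (2 * \<theta>)) = cis (2 * (t + 2 * \<theta>))" by (simp add: cis_mult algebra_simps)
  show ?thesis
  proof (cases "t < 2 * \<theta>")
    case True
    then have b: "0 < 2 * \<theta> - t" "2 * \<theta> - t < pi" and ab: "\<bar>t - 2 * \<theta>\<bar> = 2 * \<theta> - t"
      using assms theta_le by auto
    have e2: "cis (2 * t) * cis (- (2 * (2 * \<theta>))) = cis (- (2 * (2 * \<theta> - t)))" by (simp add: cis_mult algebra_simps)
    have "Q (cis (2 * t)) = of_real q * (cis ((t + 2 * \<theta>) / 2 - pi / 4) * cis (pi / 4 - (2 * \<theta> - t) / 2))"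
      unfolding Q_def e1 e2 csqrt_one_minus_cis(1)[OF tt] csqrt_one_minus_cis(2)[OF b] q_def ab of_real_mult
      by (simp only: mult_ac)
    also have "\<dots> = of_real q * cis t"
    proof -
      have "(t + 2 * \<theta>) / 2 - pi / 4 + (pi / 4 - (2 * \<theta> - t) / 2) = t" by (simp add: field_simps)
      then show ?thesis unfolding cis_mult by (simp only:)
    qed
    finally have "cis (- t) * Q (cis (2 * t)) = of_real q * (cis (- t) * cis t)" by simp
    then have "cis (- t) * Q (cis (2 * t)) = of_real q" unfolding cis_mult by simp
    then have "Re (h (cis (2 * t)) / (1 + cis (2 * t))) = - (tan t * q * X' t)"
      unfolding H by simp
    moreover have "X' t \<le> 0" using X'_nonpos assms True theta_pos by simp
    ultimately show ?thesis using q tan by (simp add: mult_nonneg_nonpos)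
  next
    case False
    then have b: "0 < t - 2 * \<theta>" "t - 2 * \<theta> < pi" and ab: "\<bar>t - 2 * \<theta>\<bar> = t - 2 * \<theta>"
      using assms theta_pos by auto
    have e2: "cis (2 * t) * cis (- (2 * (2 * \<theta>))) = cis (2 * (t - 2 * \<theta>))" by (simp add: cis_mult algebra_simps)
    have "Q (cis (2 * t)) = of_real q * (cis ((t + 2 * \<theta>) / 2 - pi / 4) * cis ((t - 2 * \<theta>) / 2 - pi / 4))"
      unfolding Q_def e1 e2 csqrt_one_minus_cis(1)[OF tt] csqrt_one_minus_cis(1)[OF b] q_def ab of_real_mult
      by (simp only: mult_ac)
    also have "\<dots> = of_real q * cis (t - pi / 2)"
    proof -
      have "(t + 2 * \<theta>) / 2 - pi / 4 + ((t - 2 * \<theta>) / 2 - pi / 4) = t - pi / 2" by (simp add: field_simps)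
      then show ?thesis unfolding cis_mult by (simp only:)
    qed
    finally have "cis (- t) * Q (cis (2 * t)) = of_real q * (cis (- t) * cis (t - pi / 2))" by simp
    then have "cis (- t) * Q (cis (2 * t)) = - \<i> * of_real q"
      unfolding cis_mult by (simp add: complex_eq_iff)
    then have "Re (h (cis (2 * t)) / (1 + cis (2 * t))) = - (tan t * q * Y' t)"
      unfolding H by simp
    moreover have "Y' t \<le> 0" using Y'_nonpos assms False by simp
    ultimately show ?thesis using q tan by (simp add: mult_nonneg_nonpos)
  qed
qed

lemma h_circle:
  assumes "norm w = 1" "w \<noteq> 1" "w \<noteq> -1"
    "w \<notin> {cis (2 * \<theta>), cis (- (2 * \<theta>)), cis (2 * (2 * \<theta>)), cis (- (2 * (2 * \<theta>)))}"
  shows "0 \<le> Re (h w / (1 + w))"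
proof -
  have up: "0 \<le> Re (h w / (1 + w))" if "norm w = 1" "0 < Im w" "w \<noteq> cis (2 * \<theta>)" "w \<noteq> cis (2 * (2 * \<theta>))" for w
  proof -
    define t where "t = Arg w / 2"
    have "w = cis (Arg w)" using that(1) by (metis rcis_cmod_Arg rcis_def mult_1 of_real_1)
    then have w: "w = cis (2 * t)" by (simp add: t_def)
    have "0 < Arg w" "Arg w < pi" using Arg_lt_pi[of w] that(2) by auto
    then have t: "0 < t" "t < pi / 2" by (auto simp: t_def)
    have "t \<noteq> \<theta>" "t \<noteq> 2 * \<theta>" using that(3,4) unfolding w by auto
    from h_boundary[OF t this] show ?thesis unfolding w .
  qed
  have "Im w \<noteq> 0"
  proof
    assume "Im w = 0"
    then have "w = of_real (Re w)" "\<bar>Re w\<bar> = 1" using assms(1) by (auto simp: complex_eq_iff cmod_eq_Re)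
    then show False using assms(2,3) by (auto simp: abs_if complex_eq_iff split: if_splits)
  qed
  then consider "0 < Im w" | "0 < Im (cnj w)" by force
  then show ?thesis
  proof cases
    case 1
    then show ?thesis using up assms by simp
  next
    case 2
    have ne: "cnj w \<noteq> cis y" if "w \<noteq> cis (- y)" for y
      using that by (metis cis_cnj complex_cnj_cnj)
    have "0 \<le> Re (h (cnj w) / (1 + cnj w))"
    proof (rule up)
      show "cnj w \<noteq> cis (2 * \<theta>)" using assms(4) by (intro ne) blast
      show "cnj w \<noteq> cis (2 * (2 * \<theta>))" using assms(4) by (intro ne) blast
    qed (use assms 2 in auto)
    moreover have "h (cnj w) / (1 + cnj w) = cnj (h w / (1 + w))" using assms by (simp add: h_cnj)
    ultimately show ?thesis by (simp only: cnj.sel)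
  qed
qed

lemma dF_holo [holomorphic_intros]: "g holomorphic_on S \<Longrightarrow> (\<lambda>z. dF (g z)) holomorphic_on S"
  unfolding dF_def by (intro holomorphic_intros)

lemma h_holo_nbhd:
  "h holomorphic_on {w. 0 < Re (1 - w * cis (2 * (2 * \<theta>))) \<and> 0 < Re (1 - w * cis (- (2 * (2 * \<theta>))))}"
  (is "_ holomorphic_on ?S")
proof -
  have "1 - w * cis (2 * (2 * \<theta>)) \<notin> \<real>\<^sub>\<le>\<^sub>0" "1 - w * cis (- (2 * (2 * \<theta>))) \<notin> \<real>\<^sub>\<le>\<^sub>0" if "w \<in> ?S" for w
    using that unfolding complex_nonpos_Reals_iff by auto
  then show ?thesis unfolding h_def[abs_def] Q_def by (intro holomorphic_intros)
qed

lemma h_holo: "h holomorphic_on ball 0 1"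
proof (rule holomorphic_on_subset[OF h_holo_nbhd], rule subsetI)
  fix w :: complex assume w: "w \<in> ball 0 1"
  have "0 < Re (1 - w * c)" if "norm c = 1" for c :: complex
  proof -
    have "norm (w * c) < 1" using that w by (simp add: norm_mult)
    then have "Re (w * c) < 1" using complex_Re_le_cmod le_less_trans by blast
    then show ?thesis by simp
  qed
  then show "w \<in> {w. 0 < Re (1 - w * cis (2 * (2 * \<theta>))) \<and> 0 < Re (1 - w * cis (- (2 * (2 * \<theta>))))}"
    unfolding mem_Collect_eq using norm_cis by blast
qed

lemma h_cont: "continuous_on (cball 0 1) h"
proof -
  have "continuous_on (cball 0 1) (\<lambda>w. csqrt (1 - w * c))" if c: "norm c = 1" for c
  proof (rule continuous_on_compose2[of "{z. 0 < Re z \<or> z = 0}" csqrt])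
    show "continuous_on {z. 0 < Re z \<or> z = 0} csqrt"
      using isCont_csqrt_right by (auto intro!: continuous_at_imp_continuous_on)
    show "continuous_on (cball 0 1) (\<lambda>w. 1 - w * c)" by (intro continuous_intros)
    show "(\<lambda>w. 1 - w * c) ` cball 0 1 \<subseteq> {z. 0 < Re z \<or> z = 0}"
    proof (rule image_subsetI)
      fix w :: complex assume "w \<in> cball 0 1"
      then have "norm w \<le> 1" by simp
      from one_minus_unit_disc[OF this c] show "1 - w * c \<in> {z. 0 < Re z \<or> z = 0}"
        unfolding mem_Collect_eq .
    qed
  qed
  then show ?thesis unfolding h_def[abs_def] Q_def dF_def by (intro continuous_intros) auto
qed

text \<open>
  The value of \<open>h\<close> at \<open>-1\<close> is a nonnegative multiple of \<open>- X' (\<pi> / 2)\<close>: at \<open>i\<close> the boundary curve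
  crosses the imaginary axis from right to left or is stationary.
\<close>
lemma h_pole_data:
  obtains h' c where "(h has_field_derivative h') (at (-1))" "h (-1) = of_real c" "0 \<le> c"
proof -
  have "0 < 1 + cos (2 * (2 * \<theta>))"
    using cos_monotone_0_pi[of "2 * (2 * \<theta>)" pi] theta_pos theta_le by simp
  then have "-1 \<in> {w. 0 < Re (1 - w * cis (2 * (2 * \<theta>))) \<and> 0 < Re (1 - w * cis (- (2 * (2 * \<theta>))))}"
    by simp
  moreover have "open {w. 0 < Re (1 - w * cis (2 * (2 * \<theta>))) \<and> 0 < Re (1 - w * cis (- (2 * (2 * \<theta>))))}"
    by (intro open_Collect_conj open_Collect_less continuous_intros)
  ultimately have "h field_differentiable (at (-1))"
    using h_holo_nbhd holomorphic_on_imp_differentiable_at by blast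
  then obtain h' where h': "(h has_field_derivative h') (at (-1))" unfolding field_differentiable_def by blast
  have "0 \<ge> 2 * M * D (pi/2) ^ 3 * X' (pi/2)"
    using D_pos[of "pi/2"] theta_le theta_pos unfolding D_X' by simp
  moreover have "2 * M * D (pi/2) ^ 3 > 0" using D_pos[of "pi/2"] theta_le theta_pos M3 by simp
  ultimately have X: "X' (pi/2) \<le> 0" by (metis mult_pos_pos not_le)
  have "\<i> * dF (-1) = Complex (Y' (pi/2)) (- X' (pi/2))" using dF_cis[of "pi/2"] by simp
  then have "Re (dF (-1)) = - X' (pi/2)" by (simp add: complex_eq_iff)
  moreover have "Im (dF (-1)) = 0" using dF_cnj[of "-1"] by (simp add: complex_eq_iff)
  ultimately have dF: "dF (-1) = of_real (- X' (pi/2))" by (simp add: complex_eq_iff)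
  have "h (-1) = of_real (- X' (pi/2) * 2 * norm (1 - of_real (-1) * cis (2 * (2 * \<theta>))))"
    using Q_of_real[of "-1"] by (simp add: h_def dF)
  moreover have "0 \<le> - X' (pi/2) * 2 * norm (1 - of_real (-1) * cis (2 * (2 * \<theta>)))"
    using X by (intro mult_nonneg_nonneg) auto
  ultimately show thesis using that h' by blast
qed

lemma h_quotient_Re_pos:
  assumes "norm w < 1" shows "0 < Re (h w / (1 + w))"
proof -
  obtain h' c where hc: "(h has_field_derivative h') (at (-1))" "h (-1) = of_real c" "0 \<le> c"
    using h_pole_data by blast
  let ?E = "{1, cis (2 * \<theta>), cis (- (2 * \<theta>)), cis (2 * (2 * \<theta>)), cis (- (2 * (2 * \<theta>)))}"
  have nn: "0 \<le> Re (h w / (1 + w))" if "norm w < 1" for w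
  proof (rule Re_nonneg_simple_pole[OF h_holo h_cont hc, of ?E])
    show "0 \<le> Re (h u / (1 + u))" if "norm u = 1" "u \<notin> ?E" "u \<noteq> -1" for u
      using that by (intro h_circle) auto
  qed (use that in auto)
  have ne: "norm w < 1 \<Longrightarrow> 1 + w \<noteq> 0" for w :: complex
    by (metis add_eq_0_iff norm_minus_cancel norm_one less_irrefl)
  show ?thesis
  proof (cases "(\<lambda>w. h w / (1 + w)) constant_on ball 0 1")
    case True
    then have "h w / (1 + w) = h 0 / (1 + 0)" using assms unfolding constant_on_def
      by (metis centre_in_ball mem_ball_0 zero_less_one)
    moreover have "dF 0 = (\<Sum>j=1..N. if j = 1 then of_real (a j * real (2 * j - 1)) else 0)"
      unfolding dF_def by (intro sum.cong) (auto simp: power_0_left)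
    then have "dF 0 = 1" using N2 a_one by simp
    ultimately show ?thesis by (simp add: h_def Q_def)
  next
    case False
    show ?thesis
    proof (rule Re_pos_of_nonneg[OF _ _ _ False])
      show "(\<lambda>w. h w / (1 + w)) holomorphic_on ball 0 1"
        using ne by (intro holomorphic_intros h_holo) auto
    qed (use nn assms in auto)
  qed
qed

end

section \<open>A half strip as parameter domain for the half disc\<close>

lemma half_disc_koebe:
  fixes z :: complex
  assumes "norm z < 1"
  shows "0 < Re (z / (1 - z\<^sup>2)) \<longleftrightarrow> 0 < Re z"
proof -
  have n: "(norm z)\<^sup>2 < 1" using assms by (simp add: power_less_one_iff)
  then have ne: "1 - z\<^sup>2 \<noteq> 0" by (metis norm_one norm_power less_irrefl right_minus_eq)
  have "z * cnj (1 - z\<^sup>2) = z - (z * cnj z) * cnj z" by (simp add: algebra_simps power2_eq_square)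
  also have "\<dots> = z - of_real ((norm z)\<^sup>2) * cnj z" by (simp only: complex_norm_square)
  finally have eq: "z * cnj (1 - z\<^sup>2) = z - of_real ((norm z)\<^sup>2) * cnj z" .
  have "Re (z * cnj (1 - z\<^sup>2)) = (1 - (norm z)\<^sup>2) * Re z"
    unfolding eq minus_complex.sel times_complex.sel[of "of_real _"] Re_complex_of_real Im_complex_of_real cnj.sel
    by (simp add: left_diff_distrib)
  then have "Re (z / (1 - z\<^sup>2)) = (1 - (norm z)\<^sup>2) * Re z / (norm (1 - z\<^sup>2))\<^sup>2"
    by (simp only: complex_div_cnj[of z] Re_divide_of_real flip: of_real_power)
  then show ?thesis using n ne by (simp add: zero_less_divide_iff zero_less_mult_iff)
qed

lemma Re_Cayley_pos: 
  assumes "norm z < 1" shows "0 < Re ((1 + z) / (1 - z))"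
proof -
  have n: "(norm z)\<^sup>2 < 1" using assms by (simp add: power_less_one_iff)
  have ne: "1 - z \<noteq> 0" using assms by auto
  have "(1 + z) * cnj (1 - z) = 1 - z * cnj z + (z - cnj z)" by (simp add: algebra_simps)
  also have "\<dots> = of_real (1 - (norm z)\<^sup>2) + (z - cnj z)" unfolding of_real_diff complex_norm_square by simp
  finally have "Re ((1 + z) * cnj (1 - z)) = 1 - (norm z)\<^sup>2" by simp
  then have "Re ((1 + z) / (1 - z)) = (1 - (norm z)\<^sup>2) / (norm (1 - z))\<^sup>2"
    by (simp only: complex_div_cnj[of "1 + z"] Re_divide_of_real flip: of_real_power)
  then show ?thesis using n ne by simp
qed

lemma Re_sinh: "Re (sinh \<zeta>) = sinh (Re \<zeta>) * cos (Im \<zeta>)"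
  and Re_cosh: "Re (cosh \<zeta>) = cosh (Re \<zeta>) * cos (Im \<zeta>)" for \<zeta> :: complex
  by (simp_all add: sinh_def cosh_def Re_exp algebra_simps)

definition half_strip :: "complex set" where "half_strip = {\<zeta>. 0 < Re \<zeta> \<and> \<bar>Im \<zeta>\<bar> < pi / 2}"
definition half_disc :: "complex set" where "half_disc = {z. norm z < 1 \<and> 0 < Re z}"

lemma half_strip_Re_pos:
  assumes "\<zeta> \<in> half_strip" shows "0 < Re (sinh \<zeta>)" "0 < Re (cosh \<zeta>)"
proof -
  have "0 < cos (Im \<zeta>)" "0 < Re \<zeta>" using assms by (auto simp: half_strip_def intro!: cos_gt_zero_pi)
  then show "0 < Re (sinh \<zeta>)" "0 < Re (cosh \<zeta>)" by (simp_all add: Re_sinh Re_cosh)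
qed

text \<open>
  The preimage is given by the explicit formula \<open>arsinh u = ln (u + sqrt (1 + u\<^sup>2))\<close>.
\<close>
lemma sinh_half_strip_onto:
  assumes "0 < Re u" obtains \<zeta> where "\<zeta> \<in> half_strip" "sinh \<zeta> = u"
proof -
  define r where "r = csqrt (1 + u\<^sup>2)"
  have r2: "r\<^sup>2 = 1 + u\<^sup>2" by (simp add: r_def)
  have r0: "0 \<le> Re r" unfolding r_def using csqrt_principal[of "1 + u\<^sup>2"] by linarith
  have pos: "0 < Re (u + r)" using assms r0 by simp
  then have ne: "u + r \<noteq> 0" by (metis less_irrefl zero_complex.sel(1))
  define \<zeta> where "\<zeta> = Ln (u + r)"
  have e: "exp \<zeta> = u + r" using ne by (simp add: \<zeta>_def)
  have "(u + r) * (r - u) = 1" using r2 by (simp add: algebra_simps power2_eq_square)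
  then have e': "exp (- \<zeta>) = r - u" unfolding exp_minus e by (metis inverse_unique)
  have s: "sinh \<zeta> = u" by (simp add: sinh_def e e' scaleR_conv_of_real)
  have im: "\<bar>Im \<zeta>\<bar> < pi / 2" using Re_Ln_pos_lt[OF ne] pos by (simp add: \<zeta>_def)
  then have "0 < cos (Im \<zeta>)" by (intro cos_gt_zero_pi) auto
  moreover have "0 < sinh (Re \<zeta>) * cos (Im \<zeta>)" using assms by (simp add: s Re_sinh[symmetric])
  ultimately have "0 < Re \<zeta>" by (simp add: zero_less_mult_iff)
  then show thesis using that s im by (auto simp: half_strip_def)
qed

lemma convex_half_strip: "convex half_strip"
proof -
  have eq: "half_strip = {\<zeta>. 0 < Re \<zeta>} \<inter> ({\<zeta>. Im \<zeta> < pi/2} \<inter> {\<zeta>. - (pi/2) < Im \<zeta>})"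
    by (auto simp: half_strip_def)
  show ?thesis
    unfolding eq by (intro convex_Int convex_halfspace_Re_gt convex_halfspace_Im_lt convex_halfspace_Im_gt)
qed

lemma open_half_strip: "open half_strip"
  unfolding half_strip_def by (intro open_Collect_conj open_Collect_less continuous_intros)

text \<open>
  The solution of \<open>z / (1 - z\<^sup>2) = k\<close> inside the unit disc, written with the root in the denominator
  so that \<open>k = 0\<close> causes no division by zero.
\<close>
definition koebe_inv :: "complex \<Rightarrow> complex" where
  "koebe_inv k = 2 * k / (1 + csqrt (1 + 4 * k\<^sup>2))"

lemma slit_right_half: assumes "0 < Re k" shows "1 + 4 * k\<^sup>2 \<notin> \<real>\<^sub>\<le>\<^sub>0"
proof
  assume "1 + 4 * k\<^sup>2 \<in> \<real>\<^sub>\<le>\<^sub>0"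
  then have "Im (k\<^sup>2) = 0" "1 + 4 * Re (k\<^sup>2) \<le> 0" by (auto simp: complex_nonpos_Reals_iff)
  then have "Im k = 0" "1 + 4 * ((Re k)\<^sup>2 - (Im k)\<^sup>2) \<le> 0"
    using assms by (auto simp: Re_power2 Im_power2)
  then have "1 + 4 * (Re k)\<^sup>2 \<le> 0" by simp
  moreover have "0 \<le> (Re k)\<^sup>2" by simp
  ultimately show False by linarith
qed

text \<open>
  With \<open>c = sqrt (1 + 4 k\<^sup>2)\<close> the point \<open>z\<close> satisfies \<open>z\<^sup>2 = (c - 1) / (c + 1)\<close>, the Cayley transform of a
  point in the right half plane.
\<close>
lemma koebe_inv:
  assumes "0 < Re k"
  shows "koebe_inv k \<in> half_disc" "koebe_inv k / (1 - (koebe_inv k)\<^sup>2) = k"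
proof -
  define c where "c = csqrt (1 + 4 * k\<^sup>2)"
  have c2: "c\<^sup>2 = 1 + 4 * k\<^sup>2" by (simp add: c_def)
  have cpos: "0 < Re c"
  proof (rule ccontr)
    assume "\<not> 0 < Re c"
    then have "Re c = 0" using csqrt_principal[of "1 + 4 * k\<^sup>2"] by (auto simp: c_def)
    then have "c\<^sup>2 \<in> \<real>\<^sub>\<le>\<^sub>0" by (simp add: complex_nonpos_Reals_iff Re_power2 Im_power2)
    then show False using slit_right_half[OF assms] c2 by simp
  qed
  define z where "z = 2 * k / (1 + c)"
  have ne: "1 + c \<noteq> 0" using cpos by (auto simp: complex_eq_iff)
  have z2: "z\<^sup>2 = (c - 1) / (c + 1)"
  proof -
    have "z\<^sup>2 = (c\<^sup>2 - 1) / (1 + c)\<^sup>2" by (simp add: z_def power_divide power_mult_distrib c2)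
    also have "\<dots> = (c - 1) * (1 + c) / ((1 + c) * (1 + c))" by (simp add: algebra_simps power2_eq_square)
    finally show ?thesis using ne by (simp add: add.commute)
  qed
  have d: "1 - z\<^sup>2 = 2 / (1 + c)" unfolding z2 using ne by (simp add: divide_simps add.commute)
  then have kz: "z / (1 - z\<^sup>2) = k" using ne by (simp add: z_def)
  have "norm (c - 1) < norm (c + 1)"
  proof -
    have "norm (c - 1) ^ 2 < norm (c + 1) ^ 2" using cpos unfolding cmod_power2
      by (simp add: power2_eq_square algebra_simps)
    then show ?thesis by (rule power_less_imp_less_base) simp
  qed
  then have "norm (z\<^sup>2) < 1" unfolding z2 norm_divide by (subst divide_less_eq_1_pos) (auto intro: le_less_trans)
  then have "norm z < 1" by (simp add: norm_power power_less_one_iff)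
  then have "z \<in> half_disc" using half_disc_koebe[of z] assms kz by (simp add: half_disc_def)
  then show "koebe_inv k \<in> half_disc" "koebe_inv k / (1 - (koebe_inv k)\<^sup>2) = k"
    using kz by (simp_all add: koebe_inv_def z_def c_def)
qed

lemma koebe_inv_koebe:
  assumes "z \<in> half_disc"
  shows "0 < Re (z / (1 - z\<^sup>2))" "koebe_inv (z / (1 - z\<^sup>2)) = z"
proof -
  have z: "norm z < 1" "0 < Re z" using assms by (auto simp: half_disc_def)
  then show "0 < Re (z / (1 - z\<^sup>2))" using half_disc_koebe by simp
  have n: "norm (z\<^sup>2) < 1" using z by (simp add: norm_power power_less_one_iff)
  then have ne: "1 - z\<^sup>2 \<noteq> 0" by auto
  have cs: "csqrt (1 + 4 * (z / (1 - z\<^sup>2))\<^sup>2) = (1 + z\<^sup>2) / (1 - z\<^sup>2)"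
  proof (rule csqrt_unique)
    show "((1 + z\<^sup>2) / (1 - z\<^sup>2))\<^sup>2 = 1 + 4 * (z / (1 - z\<^sup>2))\<^sup>2"
      using ne by (simp add: power_divide divide_simps) (simp add: algebra_simps power2_eq_square)
    show "0 < Re ((1 + z\<^sup>2) / (1 - z\<^sup>2)) \<or> Re ((1 + z\<^sup>2) / (1 - z\<^sup>2)) = 0 \<and> 0 \<le> Im ((1 + z\<^sup>2) / (1 - z\<^sup>2))"
      using Re_Cayley_pos[OF n] by simp
  qed
  have "1 + (1 + z\<^sup>2) / (1 - z\<^sup>2) = 2 / (1 - z\<^sup>2)" using ne by (simp add: divide_simps)
  then show "koebe_inv (z / (1 - z\<^sup>2)) = z"
    using ne unfolding koebe_inv_def cs by simp
qed

lemma koebe_inv_differentiable: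
  assumes "0 < Re k" shows "koebe_inv field_differentiable (at k)"
proof -
  have "koebe_inv holomorphic_on {k. 0 < Re k}"
  proof -
    have "1 + csqrt (1 + 4 * k\<^sup>2) \<noteq> 0" for k
    proof
      assume "1 + csqrt (1 + 4 * k\<^sup>2) = 0"
      then have "csqrt (1 + 4 * k\<^sup>2) = -1" by (metis add_eq_0_iff)
      then show False using csqrt_principal[of "1 + 4 * k\<^sup>2"] by simp
    qed
    then show ?thesis unfolding koebe_inv_def[abs_def] using slit_right_half
      by (intro holomorphic_intros) auto
  qed
  then show ?thesis using assms open_halfspace_Re_gt[of 0]
    by (intro holomorphic_on_imp_differentiable_at) auto
qed

context cheb_param begin

section \<open>Injectivity\<close>

definition p :: "complex \<Rightarrow> complex" where "p \<zeta> = koebe_inv (sinh \<zeta> / of_real (2 * sin (2 * \<theta>)))"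

lemma sin2_pos: "0 < sin (2 * \<theta>)" using theta_pos theta_le by (intro sin_gt_zero) auto

lemma p_arg: "\<zeta> \<in> half_strip \<Longrightarrow> 0 < Re (sinh \<zeta> / of_real (2 * sin (2 * \<theta>)))"
  using half_strip_Re_pos sin2_pos by (simp add: Re_divide_of_real del: of_real_mult)

lemma p_half_disc: "\<zeta> \<in> half_strip \<Longrightarrow> p \<zeta> \<in> half_disc"
  unfolding p_def using koebe_inv p_arg by blast

lemma p_koebe: "\<zeta> \<in> half_strip \<Longrightarrow> p \<zeta> / (1 - (p \<zeta>)\<^sup>2) = sinh \<zeta> / of_real (2 * sin (2 * \<theta>))"
  unfolding p_def using koebe_inv p_arg by blast

lemma p_onto: "half_disc \<subseteq> p ` half_strip"
proof
  fix z assume z: "z \<in> half_disc"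
  define u where "u = of_real (2 * sin (2 * \<theta>)) * (z / (1 - z\<^sup>2))"
  have "0 < Re u" unfolding u_def Re_complex_of_real times_complex.sel Im_complex_of_real
    using koebe_inv_koebe(1)[OF z] sin2_pos by simp
  then obtain \<zeta> where \<zeta>: "\<zeta> \<in> half_strip" "sinh \<zeta> = u" by (rule sinh_half_strip_onto)
  then have "p \<zeta> = z" using sin2_pos koebe_inv_koebe(2)[OF z] by (simp add: p_def u_def)
  then show "z \<in> p ` half_strip" using \<zeta> by auto
qed

lemma p_differentiable: "\<zeta> \<in> half_strip \<Longrightarrow> p field_differentiable (at \<zeta>)"
proof -
  assume \<zeta>: "\<zeta> \<in> half_strip"
  obtain k' where "(koebe_inv has_field_derivative k') (at (sinh \<zeta> / of_real (2 * sin (2 * \<theta>))))"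
    using koebe_inv_differentiable[OF p_arg[OF \<zeta>]] unfolding field_differentiable_def by blast
  moreover have "((\<lambda>\<zeta>. sinh \<zeta> / of_real (2 * sin (2 * \<theta>))) has_field_derivative
      cosh \<zeta> / of_real (2 * sin (2 * \<theta>))) (at \<zeta>)"
    by (intro DERIV_cdivide) (auto intro!: derivative_eq_intros)
  ultimately show "p field_differentiable (at \<zeta>)"
    unfolding field_differentiable_def p_def[abs_def]
    using DERIV_chain2[of koebe_inv k' "\<lambda>\<zeta>. sinh \<zeta> / of_real (2 * sin (2 * \<theta>))" \<zeta>] by blast
qed

lemma one_minus_p_squared: assumes "\<zeta> \<in> half_strip"
  shows "norm ((p \<zeta>)\<^sup>2) < 1" "1 - (p \<zeta>)\<^sup>2 \<noteq> 0" "1 + (p \<zeta>)\<^sup>2 \<noteq> 0"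
proof -
  show *: "norm ((p \<zeta>)\<^sup>2) < 1"
    using p_half_disc[OF assms] by (simp add: half_disc_def norm_power power_less_one_iff)
  show "1 - (p \<zeta>)\<^sup>2 \<noteq> 0" using * by (metis norm_one less_irrefl right_minus_eq)
  show "1 + (p \<zeta>)\<^sup>2 \<noteq> 0" using * by (metis add_eq_0_iff norm_minus_cancel norm_one less_irrefl)
qed

text \<open>
  Both sides are square roots of \<open>1 + sinh\<^sup>2 \<zeta>\<close>. The signs are compared at \<open>\<zeta> = 1\<close>, where all
  quantities are real and the two roots are nonnegative.
\<close>
lemma cosh_eq_Q:
  assumes "\<zeta> \<in> half_strip" shows "cosh \<zeta> = Q ((p \<zeta>)\<^sup>2) / (1 - (p \<zeta>)\<^sup>2)"
proof -
  let ?g = "\<lambda>\<zeta>. Q ((p \<zeta>)\<^sup>2) / (1 - (p \<zeta>)\<^sup>2)"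
  have sq: "cosh \<zeta> ^ 2 = ?g \<zeta> ^ 2" if \<zeta>: "\<zeta> \<in> half_strip" for \<zeta>
  proof -
    have s: "sinh \<zeta> = 2 * of_real (sin (2 * \<theta>)) * (p \<zeta> / (1 - (p \<zeta>)\<^sup>2))"
      unfolding p_koebe[OF \<zeta>] using sin2_pos by simp
    have "?g \<zeta> ^ 2 = 1 + (sinh \<zeta>)\<^sup>2"
      unfolding power_divide Q_squared s using one_minus_p_squared[OF \<zeta>]
      by (simp add: power_mult_distrib divide_simps)
    then show ?thesis by (simp add: cosh_square_eq)
  qed
  have contp: "continuous_on half_strip p"
    using p_differentiable field_differentiable_imp_continuous_at
    by (auto intro!: continuous_at_imp_continuous_on)
  have contQ: "continuous_on (ball 0 1) Q"
  proof -
    have c: "continuous_on (ball 0 1) (\<lambda>w. csqrt (1 - w * c))" if "norm c = 1" for c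
    proof (intro continuous_at_imp_continuous_on ballI)
      fix w :: complex assume "w \<in> ball 0 1"
      then have "isCont csqrt (1 - w * c)"
        using one_minus_unit_disc[of w c] that by (intro isCont_csqrt_right) auto
      then show "isCont (\<lambda>w. csqrt (1 - w * c)) w"
        by (intro isCont_o2[of w "\<lambda>w. 1 - w * c" csqrt] continuous_intros)
    qed
    show ?thesis unfolding Q_def[abs_def] by (intro continuous_on_mult c) simp_all
  qed
  have one: "1 \<in> half_strip" by (simp add: half_strip_def)
  show ?thesis
  proof (rule eq_if_squares_eq[of half_strip cosh ?g 1])
    show "connected half_strip" by (rule convex_connected[OF convex_half_strip])
    show "continuous_on half_strip cosh" by (intro continuous_intros)
    have "continuous_on half_strip (\<lambda>\<zeta>. Q ((p \<zeta>)\<^sup>2))"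
      by (rule continuous_on_compose2[OF contQ]) (auto intro!: continuous_intros contp simp: one_minus_p_squared)
    then show "continuous_on half_strip ?g"
      using one_minus_p_squared by (intro continuous_intros contp) auto
    show "?g \<zeta> \<noteq> 0" if "\<zeta> \<in> half_strip" for \<zeta>
      using one_minus_p_squared[OF that] Q_nonzero by simp
    show "cosh 1 = ?g 1"
    proof -
      define x :: real where "x = sinh 1 / (2 * sin (2 * \<theta>))"
      have e: "exp (1::complex) = of_real (exp 1)" "exp (- 1::complex) = of_real (exp (- 1))"
        using exp_of_real[of 1] exp_of_real[of "-1"] by simp_all
      have sinh1: "sinh (1::complex) = of_real (sinh 1)" and cosh1: "cosh (1::complex) = of_real (cosh 1)"
        by (simp_all add: sinh_def cosh_def e scaleR_conv_of_real)
      have "sinh 1 / of_real (2 * sin (2 * \<theta>)) = (of_real x :: complex)" by (simp add: x_def sinh1)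
      moreover have "csqrt (1 + 4 * (of_real x)\<^sup>2) = of_real (sqrt (1 + 4 * x\<^sup>2))"
        using csqrt_of_real_nonneg[of "of_real (1 + 4 * x\<^sup>2)"] by simp
      ultimately have "p 1 = of_real (2 * x / (1 + sqrt (1 + 4 * x\<^sup>2)))"
        by (simp add: p_def koebe_inv_def)
      then obtain r where r: "p 1 = of_real r" by blast
      have r1: "r\<^sup>2 < 1" using one_minus_p_squared(1)[OF one] unfolding r by (simp add: norm_power)
      obtain y where y: "Q ((p 1)\<^sup>2) = of_real y" "0 \<le> y"
        using Q_of_real[of "r\<^sup>2"] r1 unfolding r by (auto simp flip: of_real_power)
      have g: "?g 1 = of_real (y / (1 - r\<^sup>2))" unfolding y(1) unfolding r by simp
      have "of_real ((cosh 1)\<^sup>2) = (of_real ((y / (1 - r\<^sup>2))\<^sup>2) :: complex)"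
        using sq[OF one] unfolding g cosh1 of_real_power .
      then have "(cosh 1)\<^sup>2 = (y / (1 - r\<^sup>2))\<^sup>2" by (simp only: of_real_eq_iff)
      moreover have "0 \<le> cosh (1::real)" using cosh_real_ge_1[of 1] by linarith
      moreover have "0 \<le> y / (1 - r\<^sup>2)" using r1 y(2) by simp
      ultimately have "cosh 1 = y / (1 - r\<^sup>2)" by (rule power2_eq_imp_eq)
      then have "cosh 1 = (of_real (y / (1 - r\<^sup>2)) :: complex)" by (simp only: cosh1)
      then show ?thesis by (simp only: g)
    qed
  qed (use sq one assms in auto)
qed

text \<open>
  Differentiating \<open>p / (1 - p\<^sup>2) = sinh \<zeta> / (2 sin (2 \<theta>))\<close> gives \<open>p'\<close> in terms of \<open>p\<close> and \<open>cosh \<zeta>\<close>.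
  Since \<open>cosh \<zeta> = Q w / (1 - w)\<close> with \<open>w = p\<^sup>2\<close>, the derivative of \<open>F \<circ> p\<close> is \<open>h w / (1 + w)\<close>
  divided by \<open>2 sin (2 \<theta>)\<close>.
\<close>
lemma F0_p_deriv:
  assumes "\<zeta> \<in> half_strip"
  shows "\<exists>d. ((\<lambda>\<zeta>. F0 N (p \<zeta>)) has_field_derivative d) (at \<zeta>) \<and> 0 < Re d"
proof -
  obtain p' where p': "(p has_field_derivative p') (at \<zeta>)"
    using p_differentiable[OF assms] unfolding field_differentiable_def by blast
  define w where "w = (p \<zeta>)\<^sup>2"
  note nz = one_minus_p_squared[OF assms, folded w_def]
  have "((\<lambda>\<zeta>. 1 - (p \<zeta>)\<^sup>2) has_field_derivative - (2 * p \<zeta> * p')) (at \<zeta>)"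
    by (auto intro!: derivative_eq_intros p')
  from DERIV_divide[OF p' this] one_minus_p_squared(2)[OF assms]
  have "((\<lambda>\<zeta>. p \<zeta> / (1 - (p \<zeta>)\<^sup>2)) has_field_derivative (p' * (1 + w) / (1 - w)\<^sup>2)) (at \<zeta>)"
    by (simp add: w_def power2_eq_square algebra_simps)
  moreover have "((\<lambda>\<zeta>. p \<zeta> / (1 - (p \<zeta>)\<^sup>2)) has_field_derivative (cosh \<zeta> / of_real (2 * sin (2 * \<theta>)))) (at \<zeta>)"
  proof (rule has_field_derivative_transform_within_open[OF _ open_half_strip assms])
    show "((\<lambda>\<zeta>. sinh \<zeta> / of_real (2 * sin (2 * \<theta>))) has_field_derivative (cosh \<zeta> / of_real (2 * sin (2 * \<theta>)))) (at \<zeta>)"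
      by (intro DERIV_cdivide) (auto intro!: derivative_eq_intros)
  qed (simp only: p_koebe)
  ultimately have "p' * (1 + w) / (1 - w)\<^sup>2 = cosh \<zeta> / of_real (2 * sin (2 * \<theta>))"
    by (rule DERIV_unique)
  then have "p' * (1 + w) / (1 - w)\<^sup>2 = Q w / (1 - w) / of_real (2 * sin (2 * \<theta>))"
    unfolding cosh_eq_Q[OF assms] w_def .
  then have p'_eq: "p' = (1 - w) * Q w / (1 + w) / of_real (2 * sin (2 * \<theta>))"
    using nz sin2_pos by (simp add: divide_simps power2_eq_square) 
  have "((\<lambda>\<zeta>. F0 N (p \<zeta>)) has_field_derivative dF w * p') (at \<zeta>)"
    unfolding w_def by (rule DERIV_chain2[OF F0_deriv p'])
  moreover have "dF w * p' = (h w / (1 + w)) / of_real (2 * sin (2 * \<theta>))"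
    unfolding p'_eq h_def by simp
  then have "Re (dF w * p') = Re (h w / (1 + w)) / (2 * sin (2 * \<theta>))"
    by (simp only: Re_divide_of_real)
  then have "0 < Re (dF w * p')" using h_quotient_Re_pos[OF nz(1)] sin2_pos by simp
  ultimately show ?thesis by blast
qed

lemma inj_half_disc: "inj_on (F0 N) half_disc"
proof (rule inj_on_of_Re_deriv_pos[OF convex_half_strip p_onto])
  show "p ` half_strip \<subseteq> half_disc" using p_half_disc by blast
qed (rule F0_p_deriv)

lemma F0_cnj: "F0 N (cnj z) = cnj (F0 N z)" by (simp add: F0_a)

lemma F0_minus: "F0 N (- z) = - F0 N z"
  unfolding F0_a sum_negf[symmetric]
proof (rule sum.cong[OF refl])
  fix j assume "j \<in> {1..N}"
  then have "odd (2 * j - 1)" by simp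
  then show "of_real (a j) * (- z) ^ (2 * j - 1) = - (of_real (a j) * z ^ (2 * j - 1))"
    by (simp add: power_minus_odd)
qed

lemma Re_F0_imaginary: assumes "Re z = 0" shows "Re (F0 N z) = 0"
proof -
  have "cnj z = - z" using assms by (simp add: complex_eq_iff)
  then have "cnj (F0 N z) = - F0 N z" using F0_cnj[of z] F0_minus[of z] by simp
  then show ?thesis by (simp add: complex_eq_iff)
qed

text \<open>
  On the boundary of the half disc the real part is zero on the diameter and nonnegative on the
  arc by \<open>X_nonneg\<close>.
\<close>
lemma Re_F0_pos:
  assumes "norm z < 1" "0 < Re z" shows "0 < Re (F0 N z)"
proof (rule Re_pos_of_nonneg[of "F0 N" half_disc])
  have holo: "F0 N holomorphic_on S" for S
    unfolding F0_a[abs_def] by (intro holomorphic_intros)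
  then show "F0 N holomorphic_on half_disc" .
  have Int: "half_disc = ball 0 1 \<inter> {z. 0 < Re z}" by (auto simp: half_disc_def)
  show op: "open half_disc" unfolding Int by (intro open_Int open_ball open_halfspace_Re_gt)
  have "convex half_disc" unfolding Int by (intro convex_Int convex_ball convex_halfspace_Re_gt)
  then show "connected half_disc" by (rule convex_connected)
  show "z \<in> half_disc" using assms by (simp add: half_disc_def)
  show "\<not> F0 N constant_on half_disc"
  proof
    assume "F0 N constant_on half_disc"
    moreover have "1/2 \<in> half_disc" "1/3 \<in> half_disc" by (auto simp: half_disc_def)
    ultimately have "F0 N (1/2) = F0 N (1/3)" unfolding constant_on_def by metis
    then have "(1/2 :: complex) = 1/3"
      by (rule inj_onD[OF inj_half_disc]) (auto simp: half_disc_def)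
    then show False by simp
  qed
  fix z assume z: "z \<in> half_disc"
  have "Re (- F0 N z) \<le> 0"
  proof (rule maximum_real_frontier[of "\<lambda>z. - F0 N z" half_disc])
    show "(\<lambda>z. - F0 N z) holomorphic_on interior half_disc" by (intro holomorphic_intros holo)
    show "continuous_on (closure half_disc) (\<lambda>z. - F0 N z)"
      by (intro continuous_intros holomorphic_on_imp_continuous_on holo)
    show "bounded half_disc" unfolding Int by (simp add: bounded_Int)
    show "Re (- F0 N u) \<le> 0" if u: "u \<in> frontier half_disc" for u
    proof -
      have "closure half_disc \<subseteq> cball 0 1 \<inter> {z. 0 \<le> Re z}"
        unfolding Int by (intro closure_minimal closed_Int closed_cball closed_halfspace_Re_ge) auto
      then have u1: "norm u \<le> 1" "0 \<le> Re u" using u by (auto simp: frontier_def)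
      have "u \<notin> half_disc" using u op by (auto simp: frontier_def interior_open)
      then consider "Re u = 0" | "norm u = 1" using u1 by (fastforce simp: half_disc_def)
      then show ?thesis
      proof cases
        case 1
        then show ?thesis using Re_F0_imaginary by simp
      next
        case 2
        then have "u = cis (Arg u)" by (metis rcis_cmod_Arg rcis_def mult_1 of_real_1)
        moreover have "\<bar>Arg u\<bar> \<le> pi / 2" using u1 2 Arg_Re_nonneg[of u] by auto
        ultimately show ?thesis using X_nonneg[of "Arg u"] by (simp add: X_def)
      qed
    qed
  qed (rule z)
  then show "0 \<le> Re (F0 N z)" by simp
qed

text \<open>
  At a point \<open>z\<close> of the imaginary diameter \<open>w = z\<^sup>2\<close> is real and negative or zero. There \<open>h w / (1 + w)\<close> is a
  nonnegative multiple of the real number \<open>F' z\<close>, hence \<open>F' z > 0\<close>.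
\<close>
lemma inj_imaginary: "inj_on (F0 N) {z. norm z < 1 \<and> Re z = 0}"
proof -
  have "inj_on (\<lambda>z. F0 N z / \<i>) {z. norm z < 1 \<and> Re z = 0}"
  proof (rule inj_on_of_Re_deriv_pos[of "of_real ` {-1<..<1}" _ "\<lambda>\<zeta>. \<i> * \<zeta>"])
    show "convex (of_real ` {-1<..<1::real} :: complex set)"
      by (intro convex_linear_image bounded_linear.linear[OF bounded_linear_of_real]) simp
    show "{z. norm z < 1 \<and> Re z = 0} \<subseteq> (\<lambda>\<zeta>. \<i> * \<zeta>) ` of_real ` {-1<..<1}"
    proof
      fix z assume z: "z \<in> {z. norm z < 1 \<and> Re z = 0}"
      then have "\<bar>Im z\<bar> < 1" using abs_Im_le_cmod le_less_trans by blast
      then show "z \<in> (\<lambda>\<zeta>. \<i> * \<zeta>) ` of_real ` {-1<..<1}" using z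
        by (intro image_eqI[of _ _ "of_real (Im z)"]) (auto simp: complex_eq_iff)
    qed
    show "(\<lambda>\<zeta>. \<i> * \<zeta>) ` of_real ` {-1<..<1} \<subseteq> {z. norm z < 1 \<and> Re z = 0}"
      by (auto simp: norm_mult)
    fix \<zeta> :: complex assume "\<zeta> \<in> of_real ` {-1<..<1}"
    then obtain y where y: "\<zeta> = of_real y" "\<bar>y\<bar> < 1" by (auto simp: abs_less_iff)
    then have y2: "y\<^sup>2 < 1" by (simp add: abs_square_less_1)
    let ?w = "of_real (- (y\<^sup>2)) :: complex"
    have "Im (dF ?w) = 0" using dF_cnj[of ?w] by (simp add: complex_eq_iff)
    then have f: "dF ?w = of_real (Re (dF ?w))" by (simp add: complex_eq_iff)
    obtain q where q: "Q ?w = of_real q" "0 \<le> q" using Q_of_real[of "- (y\<^sup>2)"] y2 by auto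
    have "h ?w / (1 + ?w) = of_real (Re (dF ?w) * ((1 + y\<^sup>2) * q / (1 - y\<^sup>2)))"
      unfolding h_def q(1) by (subst f) simp
    moreover have "0 < Re (h ?w / (1 + ?w))" using y2 by (intro h_quotient_Re_pos) (simp add: norm_power)
    ultimately have "0 < Re (dF ?w) * ((1 + y\<^sup>2) * q / (1 - y\<^sup>2))" by (simp only: Re_complex_of_real)
    moreover have "0 \<le> (1 + y\<^sup>2) * q / (1 - y\<^sup>2)" using q y2 by simp
    ultimately have pos: "0 < Re (dF ?w)" by (metis mult_nonpos_nonneg not_le)
    have d: "((\<lambda>\<zeta>. F0 N (\<i> * \<zeta>)) has_field_derivative dF ((\<i> * \<zeta>)\<^sup>2) * \<i>) (at \<zeta>)"
      by (rule DERIV_chain2[OF F0_deriv]) (auto intro!: derivative_eq_intros)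
    have sq: "(\<i> * \<zeta>)\<^sup>2 = ?w" by (simp add: y power_mult_distrib)
    have e: "dF ((\<i> * \<zeta>)\<^sup>2) * \<i> / \<i> = dF ?w"
      unfolding sq by (rule nonzero_mult_div_cancel_right) simp
    have "((\<lambda>\<zeta>. F0 N (\<i> * \<zeta>) / \<i>) has_field_derivative dF ?w) (at \<zeta>)"
      by (rule DERIV_cdivide[OF d, of \<i>, unfolded e])
    then show "\<exists>d. ((\<lambda>\<zeta>. F0 N (\<i> * \<zeta>) / \<i>) has_field_derivative d) (at \<zeta>) \<and> 0 < Re d"
      using pos by blast
  qed
  then show ?thesis by (auto simp: inj_on_def)
qed

lemma inj_disc: "inj_on (F0 N) {z. norm z < 1}"
proof (rule inj_onI)
  fix x y assume "x \<in> {z. norm z < 1}" "y \<in> {z. norm z < 1}" and eq: "F0 N x = F0 N y"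
  then have x: "norm x < 1" and y: "norm y < 1" by auto
  have sgn: "sgn (Re (F0 N z)) = sgn (Re z)" if "norm z < 1" for z
  proof (cases "Re z = 0")
    case True
    then show ?thesis using Re_F0_imaginary by simp
  next
    case False
    then consider "0 < Re z" | "0 < Re (- z)" by fastforce
    then show ?thesis
    proof cases
      case 1
      then show ?thesis using Re_F0_pos that by simp
    next
      case 2
      then show ?thesis using Re_F0_pos[of "- z"] that F0_minus[of z] by simp
    qed
  qed
  have s: "sgn (Re x) = sgn (Re y)" using sgn[OF x] sgn[OF y] eq by simp
  consider "Re x > 0" | "Re x = 0" | "Re x < 0" by linarith
  then show "x = y"
  proof cases
    case 1
    then have "Re y > 0" using s by (metis sgn_greater)
    then show ?thesis using 1 x y eq inj_half_disc by (auto simp: inj_on_def half_disc_def)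
  next
    case 2
    then have "Re y = 0" using s by (simp add: sgn_0_0)
    then show ?thesis using 2 x y eq inj_imaginary by (auto simp: inj_on_def)
  next
    case 3
    then have "Re y < 0" using s by (metis sgn_less)
    then have "- x = - y" using 3 x y eq inj_onD[OF inj_half_disc, of "-x" "-y"]
      by (simp add: half_disc_def F0_minus)
    then show ?thesis by simp
  qed
qed

end

theorem theorem3:
  fixes N :: nat
  assumes "N \<ge> 1"
  shows "inj_on (F0 N) {z. norm z < 1}"
proof (cases "N = 1")
  case True
  have "poly (pderiv (cheb_U 2)) (cos (pi / 4)) \<noteq> 0"
    by (simp add: cheb_U_eq_rec numeral_2_eq_2 pderiv_mult pderiv_diff pderiv_pCons cos_45)
  then have "F0 N = (\<lambda>z. z)" by (simp add: F0_def True fun_eq_iff)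
  then show ?thesis by (simp add: inj_on_def)
next
  case False
  then interpret cheb_param N using assms by unfold_locales simp
  show ?thesis by (rule inj_disc)
qed

end
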